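(* Let $H,K$ be finite-dimensional Hilbert spaces; let $N$ be a finite-dimensional $C^{*}$-algebra with a faithful state $\mu$ and nondegenerate faithful representations $\rho\colon N^{op}\to\mathcal{L}(H)$ and $\sigma\colon N\to\mathcal{L}(K)$; let $(\mathfrak{H},\mathfrak{B},\mathfrak{B}^{\dagger})$ be a finite-dimensional standard $C^{*}$-base with bicyclic vector $\zeta\in\mathfrak{H}$, let $\alpha$ be a $C^{*}$-factorization of $H$ with respect to $(\mathfrak{H},\mathfrak{B},\mathfrak{B}^{\dagger})$ and $\beta$ a $C^{*}$-factorization of $K$ with respect to $(\mathfrak{H},\mathfrak{B}^{\dagger},\mathfrak{B})$. Let $U\colon\mathfrak{H}\to H_{\mu}$ be a unitary such that $$U\mathfrak{B}U^{*}=\pi_{\mu}(N),\quad U\mathfrak{B}^{\dagger}U^{*}=\pi_{\mu}^{op}(N^{op}),\quad U\zeta=\zeta_{\mu},\quad \rho=\rho_{\alpha}\circ\mathrm{Ad}_{U^{*}}\circ\pi_{\mu}^{op},\quad \sigma=\rho_{\beta}\circ\mathrm{Ad}_{U^{*}}\circ\pi_{\mu}.$$ Then there exists a unitary $$\Phi^{U,\zeta}_{\alpha,\beta}\colon H\,{}_{\rho}\underset{\mu}{\otimes}{}_{\sigma}\,K\to H\,{}_{\alpha}\underset{\mathfrak{H}}{\otimes}{}_{\beta}\,K,\qquad \xi\,{}_{\rho}\underset{\mu}{\otimes}{}_{\sigma}\,\eta\mapsto R^{\rho}_{\mu^{op}}(\xi)U\otimes\zeta\otimes R^{\sigma}_{\mu}(\eta)U\quad(\xi\in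 H,\ \eta\in K).$$
   Context: Inner products are conjugate-linear in the first variable. $[Y]$ denotes the closed linear span of $Y$; $XY$ denotes the set of products; $\mathrm{Ad}_{U}(x)=UxU^{*}$. A $C^{*}$-base is a triple $(\mathfrak{H},\mathfrak{B},\mathfrak{B}^{\dagger})$ of a Hilbert space $\mathfrak{H}$ and two commuting nondegenerate $C^{*}$-algebras $\mathfrak{B},\mathfrak{B}^{\dagger}\subseteq\mathcal{L}(\mathfrak{H})$; it is finite-dimensional if $\dim\mathfrak{H}<\infty$, and standard if there is a bicyclic vector, i.e. a vector $\zeta\in\mathfrak{H}$ cyclic for both $\mathfrak{B}$ and $\mathfrak{B}^{\dagger}$. Then $(\mathfrak{H},\mathfrak{B}^{\dagger},\mathfrak{B})$ is also a $C^{*}$-base. A $C^{*}$-factorization of a Hilbert space $H$ with respect to $(\mathfrak{H},\mathfrak{B},\mathfrak{B}^{\dagger})$ is a closed subspace $\alpha\subseteq\mathcal{L}(\mathfrak{H},H)$ with $[\alpha^{*}\alpha]=\mathfrak{B}$, $[\alpha\mathfrak{B}]=\alpha$, $[\alpha\mathfrak{H}]=H$. It determines a unique nondegenerate faithful representation $\rho_{\alpha}\colon\mathfrak{B}^{\dagger}\to\mathcal{L}(H)$ with $\rho_{\alpha}(b^{\dagger})\xi\omega=\xi b^{\dagger}\omega$ for $b^{\dagger}\in\mathfrak{B}^{\dagger}$, $\xi\in\alpha$, $\omega\in\mathfrak{H}$. Similarly, a $C^{*}$-factorization $\beta$ with respect to $(\mathfrak{H},\mathfrak{B}^{\dagger},\mathfrak{B})$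 determines $\rho_{\beta}\colon\mathfrak{B}\to\mathcal{L}(K)$. For a faithful state $\mu$ on a finite-dimensional $C^{*}$-algebra $N$, $(H_{\mu},\pi_{\mu},\zeta_{\mu})$ is a GNS-representation, $J_{\mu}$ the modular conjugation (the antiunitary part of the polar decomposition of $\pi_{\mu}(b)\zeta_{\mu}\mapsto\pi_{\mu}(b^{*})\zeta_{\mu}$), and $\pi_{\mu}^{op}\colon N^{op}\to\mathcal{L}(H_{\mu})$, $\pi_{\mu}^{op}(b^{op})=J_{\mu}\pi_{\mu}(b)^{*}J_{\mu}$. Relative tensor product: for $\xi\in H$, $\eta\in K$ there are unique operators $R^{\rho}_{\mu^{op}}(\xi)\colon H_{\mu}\to H$, $\pi_{\mu}^{op}(b^{op})\zeta_{\mu}\mapsto\rho(b^{op})\xi$, and $R^{\sigma}_{\mu}(\eta)\colon H_{\mu}\to K$, $\pi_{\mu}(b)\zeta_{\mu}\mapsto\sigma(b)\eta$. The Hilbert space $H\,{}_{\rho}\underset{\mu}{\otimes}{}_{\sigma}\,K$ is obtained from $H\otimes K$ with the sesquilinear form $$\langle\xi\otimes\eta|\xi'\otimes\eta'\rangle_{\mu}=\big\langle R^{\rho}_{\mu^{op}}(\xi')^{*}R^{\rho}_{\mu^{op}}(\xi)\zeta_{\mu}\big|R^{\sigma}_{\mu}(\eta)^{*}R^{\sigma}_{\mu}(\eta')\zeta_{\mu}\big\rangle$$ by factoring out the null space of the associated seminorm; $\xi\,{}_{\rho}\underset{\mu}{\otimes}{}_{\sigma}\,\eta$ is the image of $\xi\otimes\eta$.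 $C^{*}$-relative tensor product: $H\,{}_{\alpha}\underset{\mathfrak{H}}{\otimes}{}_{\beta}\,K$ is the internal tensor product of $\alpha$ (a Hilbert $C^{*}$-module over $\mathfrak{B}$ with $\langle\xi|\xi'\rangle=\xi^{*}\xi'$), $\mathfrak{H}$, and $\beta$ (a Hilbert $C^{*}$-module over $\mathfrak{B}^{\dagger}$ with $\langle\eta|\eta'\rangle=\eta^{*}\eta'$), i.e. the Hilbert space obtained by separation and completion from the algebraic tensor product of $\alpha,\mathfrak{H},\beta$ with $$\langle\xi\otimes\omega\otimes\eta|\xi'\otimes\omega'\otimes\eta'\rangle=\langle\omega|(\xi^{*}\xi')(\eta^{*}\eta')\omega'\rangle\qquad(\xi,\xi'\in\alpha,\ \omega,\omega'\in\mathfrak{H},\ \eta,\eta'\in\beta).$$ The image of an elementary tensor is again written $\xi\otimes\omega\otimes\eta$. (Under the hypotheses of the claim, $R^{\rho}_{\mu^{op}}(\xi)U\in\alpha$ and $R^{\sigma}_{\mu}(\eta)U\in\beta$.) *)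

theory Defs
  imports "HOL-Analysis.Analysis" "HOL-Library.Poly_Mapping"
begin

section \<open>Complex normed spaces, Hilbert spaces and abstract C*-algebras\<close>

class complex_vector = real_vector +
  fixes scaleC :: "complex \<Rightarrow> 'a \<Rightarrow> 'a" (infixr \<open>*\<^sub>C\<close> 75)
  assumes scaleR_scaleC: "scaleR r x = complex_of_real r *\<^sub>C x"
    and scaleC_add_right: "c *\<^sub>C (x + y) = c *\<^sub>C x + c *\<^sub>C y"
    and scaleC_add_left: "(c + d) *\<^sub>C x = c *\<^sub>C x + d *\<^sub>C x"
    and scaleC_scaleC: "c *\<^sub>C d *\<^sub>C x = (c * d) *\<^sub>C x"
    and scaleC_one: "1 *\<^sub>C x = x"

global_interpretation complex_vector: vector_space "scaleC :: complex \<Rightarrow> 'a \<Rightarrow> 'a::complex_vector"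
  defines cspan = complex_vector.span and csubspace = complex_vector.subspace
  by unfold_locales
    (simp_all add: scaleC_add_right scaleC_add_left scaleC_scaleC scaleC_one)

definition cfinite_dim :: "'a::complex_vector set \<Rightarrow> bool" where
  "cfinite_dim V \<longleftrightarrow> (\<exists>B. finite B \<and> cspan B = V)"

class complex_normed_vector = complex_vector + real_normed_vector +
  assumes norm_scaleC: "norm (c *\<^sub>C x) = cmod c * norm x"

definition closed_cspan :: "'a::complex_normed_vector set \<Rightarrow> 'a set" where
  "closed_cspan Y = closure (cspan Y)"

class complex_inner = complex_normed_vector +
  fixes cinner :: "'a \<Rightarrow> 'a \<Rightarrow> complex"
  assumes cinner_commute: "cinner x y = cnj (cinner y x)"
    and cinner_add_right: "cinner x (y + z) = cinner x y + cinner x z"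
    and cinner_scaleC_right: "cinner x (c *\<^sub>C y) = c * cinner x y"
    and cinner_ge_zero: "0 \<le> Re (cinner x x)"
    and cinner_eq_zero_iff: "cinner x x = 0 \<longleftrightarrow> x = 0"
    and norm_eq_sqrt_cinner: "norm x = sqrt (Re (cinner x x))"

class chilbert_space = complex_inner + complete_space

text \<open>No unit is demanded.\<close>

class cstar_algebra = complex_normed_vector + real_normed_algebra + complete_space +
  fixes star :: "'a \<Rightarrow> 'a"
  assumes scaleC_mult_left: "(c *\<^sub>C x) * y = c *\<^sub>C (x * y)"
    and scaleC_mult_right: "x * (c *\<^sub>C y) = c *\<^sub>C (x * y)"
    and star_star: "star (star x) = x"
    and star_add: "star (x + y) = star x + star y"
    and star_scaleC: "star (c *\<^sub>C x) = cnj c *\<^sub>C star x"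
    and star_mult: "star (x * y) = star y * star x"
    and norm_star_mult_self: "norm (star x * x) = (norm x)\<^sup>2"

lemma norm_star:
  fixes x :: "'a::cstar_algebra"
  shows "norm (star x) = norm x"
proof -
  have le: "norm y \<le> norm (star y)" for y :: 'a
  proof (cases "y = 0")
    case False
    have "norm y * norm y \<le> norm (star y) * norm y"
      using norm_star_mult_self[of y] norm_mult_ineq[of "star y" y]
      by (simp add: power2_eq_square)
    then show ?thesis using False by simp
  qed simp
  from le[of x] le[of "star x"] show ?thesis by (simp add: star_star)
qed

instantiation complex :: chilbert_space
begin

definition scaleC_complex :: "complex \<Rightarrow> complex \<Rightarrow> complex" where
  "scaleC_complex c x = c * x"

definition cinner_complex :: "complex \<Rightarrow> complex \<Rightarrow> complex" where
  "cinner_complex x y = cnj x * y"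

instance
proof
  fix x y z c d :: complex and r :: real
  show "r *\<^sub>R x = complex_of_real r *\<^sub>C x"
    by (simp add: scaleC_complex_def scaleR_conv_of_real)
  show "norm x = sqrt (Re (cinner x x))"
    by (simp add: cinner_complex_def cmod_def power2_eq_square)
qed (auto simp: scaleC_complex_def cinner_complex_def algebra_simps norm_mult)

end

text \<open>The opposite algebra: only the order of multiplication changes.\<close>

typedef 'a opp = "UNIV :: 'a set" morphisms unop Op ..

setup_lifting type_definition_opp

instantiation opp :: (cstar_algebra) real_normed_vector
begin

lift_definition zero_opp :: "'a opp" is 0 .
lift_definition plus_opp :: "'a opp \<Rightarrow> 'a opp \<Rightarrow> 'a opp" is "(+)" .
lift_definition minus_opp :: "'a opp \<Rightarrow> 'a opp \<Rightarrow> 'a opp" is "(-)" .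
lift_definition uminus_opp :: "'a opp \<Rightarrow> 'a opp" is uminus .
lift_definition scaleR_opp :: "real \<Rightarrow> 'a opp \<Rightarrow> 'a opp" is scaleR .
lift_definition norm_opp :: "'a opp \<Rightarrow> real" is norm .

definition dist_opp :: "'a opp \<Rightarrow> 'a opp \<Rightarrow> real" where
  "dist_opp x y = norm (x - y)"
definition sgn_opp :: "'a opp \<Rightarrow> 'a opp" where
  "sgn_opp x = scaleR (inverse (norm x)) x"
definition uniformity_opp :: "('a opp \<times> 'a opp) filter" where
  "uniformity_opp = (INF e\<in>{0<..}. principal {(x, y). dist x y < e})"
definition open_opp :: "'a opp set \<Rightarrow> bool" where
  "open_opp S = (\<forall>x\<in>S. \<forall>\<^sub>F (x', y) in uniformity. x' = x \<longrightarrow> y \<in> S)"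

instance
proof
  fix x y z :: "'a opp" and r s :: real
  show "x + y + z = x + (y + z)" by transfer (simp add: add.assoc)
  show "x + y = y + x" by transfer (simp add: add.commute)
  show "0 + x = x" by transfer simp
  show "- x + x = 0" by transfer simp
  show "x - y = x + - y" by transfer simp
  show "r *\<^sub>R (x + y) = r *\<^sub>R x + r *\<^sub>R y" by transfer (rule scaleR_add_right)
  show "(r + s) *\<^sub>R x = r *\<^sub>R x + s *\<^sub>R x" by transfer (rule scaleR_add_left)
  show "r *\<^sub>R s *\<^sub>R x = (r * s) *\<^sub>R x" by transfer simp
  show "1 *\<^sub>R x = x" by transfer simp
  show "dist x y = norm (x - y)" by (rule dist_opp_def)
  show "sgn x = inverse (norm x) *\<^sub>R x" by (simp add: sgn_opp_def)
  show "uniformity = (INF e\<in>{0<..}. principal {(x :: 'a opp, y). dist x y < e})"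
    by (rule uniformity_opp_def)
  show "(norm x = 0) = (x = 0)" by transfer simp
  show "norm (x + y) \<le> norm x + norm y" by transfer (rule norm_triangle_ineq)
  show "norm (r *\<^sub>R x) = \<bar>r\<bar> * norm x" by transfer simp
next
  fix S :: "'a opp set"
  show "open S = (\<forall>x\<in>S. \<forall>\<^sub>F (x', y) in uniformity. x' = x \<longrightarrow> y \<in> S)"
    by (rule open_opp_def)
qed

end

lemma dist_unop: "dist (unop (x :: 'a::cstar_algebra opp)) (unop y) = dist x y"
  unfolding dist_opp_def by transfer (rule dist_norm)

instantiation opp :: (cstar_algebra) cstar_algebra
begin

lift_definition times_opp :: "'a opp \<Rightarrow> 'a opp \<Rightarrow> 'a opp" is "\<lambda>x y. y * x" .
lift_definition scaleC_opp :: "complex \<Rightarrow> 'a opp \<Rightarrow> 'a opp" is scaleC .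
lift_definition star_opp :: "'a opp \<Rightarrow> 'a opp" is star .

instance
proof
  fix x y z :: "'a opp" and r :: real and c d :: complex
  show "r *\<^sub>R x = complex_of_real r *\<^sub>C x" by transfer (rule scaleR_scaleC)
  show "c *\<^sub>C (x + y) = c *\<^sub>C x + c *\<^sub>C y" by transfer (rule scaleC_add_right)
  show "(c + d) *\<^sub>C x = c *\<^sub>C x + d *\<^sub>C x" by transfer (rule scaleC_add_left)
  show "c *\<^sub>C d *\<^sub>C x = (c * d) *\<^sub>C x" by transfer (rule scaleC_scaleC)
  show "1 *\<^sub>C x = x" by transfer (rule scaleC_one)
  show "x * y * z = x * (y * z)" by transfer (simp add: mult.assoc)
  show "(x + y) * z = x * z + y * z" by transfer (simp add: distrib_left)
  show "x * (y + z) = x * y + x * z" by transfer (simp add: distrib_right)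
  show "r *\<^sub>R x * y = r *\<^sub>R (x * y)" by transfer simp
  show "x * r *\<^sub>R y = r *\<^sub>R (x * y)" by transfer simp
  show "norm (c *\<^sub>C x) = cmod c * norm x" by transfer (rule norm_scaleC)
  show "norm (x * y) \<le> norm x * norm y"
    by transfer (rule norm_mult_ineq[THEN order_trans], simp)
  show "c *\<^sub>C x * y = c *\<^sub>C (x * y)" by transfer (rule scaleC_mult_right)
  show "x * c *\<^sub>C y = c *\<^sub>C (x * y)" by transfer (rule scaleC_mult_left)
  show "star (star x) = x" by transfer (rule star_star)
  show "star (x + y) = star x + star y" by transfer (rule star_add)
  show "star (c *\<^sub>C x) = cnj c *\<^sub>C star x" by transfer (rule star_scaleC)
  show "star (x * y) = star y * star x" by transfer (rule star_mult)
  show "norm (star x * x) = (norm x)\<^sup>2"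
    by transfer (metis norm_star_mult_self star_star norm_star)
next
  fix X :: "nat \<Rightarrow> 'a opp"
  assume "Cauchy X"
  then have "Cauchy (\<lambda>n. unop (X n))"
    by (simp add: Cauchy_def dist_unop)
  then obtain l where "(\<lambda>n. unop (X n)) \<longlonglongrightarrow> l"
    using Cauchy_convergent convergent_def by blast
  then have "X \<longlonglongrightarrow> Op l"
    by (simp add: lim_sequentially flip: dist_unop) (simp add: Op_inverse)
  then show "convergent X" by (auto simp: convergent_def)
qed

end


section \<open>Bounded complex-linear operators\<close>

typedef (overloaded) ('a::complex_normed_vector, 'b::complex_normed_vector) cblin =
  "{f :: 'a \<Rightarrow>\<^sub>L 'b. \<forall>c x. blinfun_apply f (c *\<^sub>C x) = c *\<^sub>C blinfun_apply f x}"
  by (rule exI[of _ 0]) (simp add: complex_vector.scale_zero_right)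

setup_lifting type_definition_cblin

lemma bounded_linear_scaleC:
  fixes f :: "'a::real_normed_vector \<Rightarrow> 'b::complex_normed_vector"
  assumes "bounded_linear f"
  shows "bounded_linear (\<lambda>x. c *\<^sub>C f x)"
proof (rule bounded_linear_compose[OF _ assms])
  show "bounded_linear (\<lambda>x::'b. c *\<^sub>C x)"
    by (rule bounded_linear_intro[where K = "cmod c"])
      (simp_all add: scaleC_add_right scaleR_scaleC scaleC_scaleC norm_scaleC mult.commute)
qed

instantiation cblin :: (complex_normed_vector, complex_normed_vector) complex_normed_vector
begin

lift_definition zero_cblin :: "('a, 'b) cblin" is 0
  by (simp add: complex_vector.scale_zero_right)
lift_definition plus_cblin :: "('a, 'b) cblin \<Rightarrow> ('a, 'b) cblin \<Rightarrow> ('a, 'b) cblin" is "(+)"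
  by (simp add: blinfun.add_left scaleC_add_right)
lift_definition minus_cblin :: "('a, 'b) cblin \<Rightarrow> ('a, 'b) cblin \<Rightarrow> ('a, 'b) cblin" is "(-)"
  by (simp add: blinfun.diff_left complex_vector.scale_right_diff_distrib)
lift_definition uminus_cblin :: "('a, 'b) cblin \<Rightarrow> ('a, 'b) cblin" is uminus
  by (simp add: blinfun.minus_left complex_vector.scale_minus_right)
lift_definition scaleR_cblin :: "real \<Rightarrow> ('a, 'b) cblin \<Rightarrow> ('a, 'b) cblin" is scaleR
  by (simp add: blinfun.scaleR_left scaleR_scaleC scaleC_scaleC mult.commute)
lift_definition scaleC_cblin :: "complex \<Rightarrow> ('a, 'b) cblin \<Rightarrow> ('a, 'b) cblin"
  is "\<lambda>c f. Blinfun (\<lambda>x. c *\<^sub>C blinfun_apply f x)"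
  by (simp add: bounded_linear_Blinfun_apply bounded_linear_scaleC blinfun.bounded_linear_right
      scaleC_scaleC mult.commute)
lift_definition norm_cblin :: "('a, 'b) cblin \<Rightarrow> real" is norm .

definition dist_cblin :: "('a, 'b) cblin \<Rightarrow> ('a, 'b) cblin \<Rightarrow> real" where
  "dist_cblin x y = norm (x - y)"
definition sgn_cblin :: "('a, 'b) cblin \<Rightarrow> ('a, 'b) cblin" where
  "sgn_cblin x = scaleR (inverse (norm x)) x"
definition uniformity_cblin :: "(('a, 'b) cblin \<times> ('a, 'b) cblin) filter" where
  "uniformity_cblin = (INF e\<in>{0<..}. principal {(x, y). dist x y < e})"
definition open_cblin :: "('a, 'b) cblin set \<Rightarrow> bool" where
  "open_cblin S = (\<forall>x\<in>S. \<forall>\<^sub>F (x', y) in uniformity. x' = x \<longrightarrow> y \<in> S)"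

instance
proof
  fix x y z :: "('a, 'b) cblin" and r s :: real and c d :: complex
  show "x + y + z = x + (y + z)" by transfer (simp add: add.assoc)
  show "x + y = y + x" by transfer (simp add: add.commute)
  show "0 + x = x" by transfer simp
  show "- x + x = 0" by transfer simp
  show "x - y = x + - y" by transfer simp
  show "r *\<^sub>R (x + y) = r *\<^sub>R x + r *\<^sub>R y" by transfer (rule scaleR_add_right)
  show "(r + s) *\<^sub>R x = r *\<^sub>R x + s *\<^sub>R x" by transfer (rule scaleR_add_left)
  show "r *\<^sub>R s *\<^sub>R x = (r * s) *\<^sub>R x" by transfer simp
  show "1 *\<^sub>R x = x" by transfer simp
  note simps = bounded_linear_Blinfun_apply bounded_linear_scaleC blinfun.bounded_linear_right
    blinfun.add_left blinfun.scaleR_left bounded_linear_add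
  show "r *\<^sub>R x = complex_of_real r *\<^sub>C x"
    by (transfer, intro blinfun_eqI) (simp add: simps scaleR_scaleC)
  show "c *\<^sub>C (x + y) = c *\<^sub>C x + c *\<^sub>C y"
    by (transfer, intro blinfun_eqI) (simp add: simps scaleC_add_right)
  show "(c + d) *\<^sub>C x = c *\<^sub>C x + d *\<^sub>C x"
    by (transfer, intro blinfun_eqI) (simp add: simps scaleC_add_left)
  show "c *\<^sub>C d *\<^sub>C x = (c * d) *\<^sub>C x"
    by (transfer, intro blinfun_eqI) (simp add: simps scaleC_scaleC)
  show "1 *\<^sub>C x = x"
    by (transfer, intro blinfun_eqI) (simp add: simps scaleC_one)
  show "dist x y = norm (x - y)" by (rule dist_cblin_def)
  show "sgn x = inverse (norm x) *\<^sub>R x" by (simp add: sgn_cblin_def)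
  show "uniformity = (INF e\<in>{0<..}. principal {(x :: ('a, 'b) cblin, y). dist x y < e})"
    by (rule uniformity_cblin_def)
  show "(norm x = 0) = (x = 0)" by transfer simp
  show "norm (x + y) \<le> norm x + norm y" by transfer (rule norm_triangle_ineq)
  show "norm (r *\<^sub>R x) = \<bar>r\<bar> * norm x" by transfer simp
  show "norm (c *\<^sub>C x) = cmod c * norm x"
  proof transfer
    fix c and f :: "'a \<Rightarrow>\<^sub>L 'b"
    have "norm (Blinfun (\<lambda>x. c *\<^sub>C blinfun_apply f x)) = onorm (\<lambda>x. c *\<^sub>C blinfun_apply f x)"
      by (simp add: norm_blinfun.rep_eq bounded_linear_Blinfun_apply
          bounded_linear_scaleC blinfun.bounded_linear_right)
    also have "\<dots> = onorm (\<lambda>x. cmod c *\<^sub>R blinfun_apply f x)"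
      by (simp add: onorm_def norm_scaleC)
    also have "\<dots> = cmod c * norm f"
      by (simp add: onorm_scaleR blinfun.bounded_linear_right norm_blinfun.rep_eq)
    finally show "norm (Blinfun (\<lambda>x. c *\<^sub>C blinfun_apply f x)) = cmod c * norm f" .
  qed
next
  fix S :: "('a, 'b) cblin set"
  show "open S = (\<forall>x\<in>S. \<forall>\<^sub>F (x', y) in uniformity. x' = x \<longrightarrow> y \<in> S)"
    by (rule open_cblin_def)
qed

end

lift_definition cblin_apply ::
  "('a::complex_normed_vector, 'b::complex_normed_vector) cblin \<Rightarrow> 'a \<Rightarrow> 'b" (infixr \<open>\<cdot>\<close> 75)
  is blinfun_apply .

lift_definition cblin_compose ::
  "('b::complex_normed_vector, 'c::complex_normed_vector) cblin \<Rightarrow>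
   ('a::complex_normed_vector, 'b) cblin \<Rightarrow> ('a, 'c) cblin" (infixl \<open>o\<^sub>C\<close> 67)
  is blinfun_compose
  by simp

lift_definition id_cblin :: "('a::complex_normed_vector, 'a) cblin" is id_blinfun
  by simp

definition cblin_of ::
  "('a::complex_normed_vector \<Rightarrow> 'b::complex_normed_vector) \<Rightarrow> ('a, 'b) cblin" where
  "cblin_of f = (THE T. \<forall>x. T \<cdot> x = f x)"

definition adj :: "('a::chilbert_space, 'b::chilbert_space) cblin \<Rightarrow> ('b, 'a) cblin" where
  "adj T = (THE S. \<forall>x y. cinner (S \<cdot> y) x = cinner y (T \<cdot> x))"

definition unitary_op :: "('a::chilbert_space, 'b::chilbert_space) cblin \<Rightarrow> bool" where
  "unitary_op U \<longleftrightarrow> adj U o\<^sub>C U = id_cblin \<and> U o\<^sub>C adj U = id_cblin"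

definition Ad :: "('a::chilbert_space, 'b::chilbert_space) cblin \<Rightarrow>
    ('a, 'a) cblin \<Rightarrow> ('b, 'b) cblin" where
  "Ad U x = U o\<^sub>C x o\<^sub>C adj U"

definition positive_op :: "('a::chilbert_space, 'a) cblin \<Rightarrow> bool" where
  "positive_op P \<longleftrightarrow> (\<forall>x. cinner x (P \<cdot> x) \<in> \<real>\<^sub>\<ge>\<^sub>0)"

definition antiunitary :: "('a::chilbert_space \<Rightarrow> 'b::chilbert_space) \<Rightarrow> bool" where
  "antiunitary J \<longleftrightarrow> surj J \<and> (\<forall>x y. J (x + y) = J x + J y) \<and>
     (\<forall>c x. J (c *\<^sub>C x) = cnj c *\<^sub>C J x) \<and> (\<forall>x y. cinner (J x) (J y) = cinner y x)"


section \<open>Representations, states and the GNS construction\<close>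

definition star_representation ::
  "('n::cstar_algebra \<Rightarrow> ('h::chilbert_space, 'h) cblin) \<Rightarrow> bool" where
  "star_representation \<pi> \<longleftrightarrow>
     (\<forall>x y. \<pi> (x + y) = \<pi> x + \<pi> y) \<and> (\<forall>c x. \<pi> (c *\<^sub>C x) = c *\<^sub>C \<pi> x) \<and>
     (\<forall>x y. \<pi> (x * y) = \<pi> x o\<^sub>C \<pi> y) \<and> (\<forall>x. \<pi> (star x) = adj (\<pi> x))"

definition nondegenerate_rep ::
  "('n::cstar_algebra \<Rightarrow> ('h::chilbert_space, 'h) cblin) \<Rightarrow> bool" where
  "nondegenerate_rep \<pi> \<longleftrightarrow> closed_cspan {\<pi> b \<cdot> x | b x. True} = UNIV"

definition faithful_state :: "('n::cstar_algebra, complex) cblin \<Rightarrow> bool" where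
  "faithful_state \<mu> \<longleftrightarrow> (\<forall>b. \<mu> \<cdot> (star b * b) \<in> \<real>\<^sub>\<ge>\<^sub>0) \<and> norm \<mu> = 1 \<and>
     (\<forall>b. \<mu> \<cdot> (star b * b) = 0 \<longrightarrow> b = 0)"

definition gns_representation ::
  "('n::cstar_algebra, complex) cblin \<Rightarrow> ('n \<Rightarrow> ('m::chilbert_space, 'm) cblin) \<Rightarrow> 'm \<Rightarrow> bool" where
  "gns_representation \<mu> \<pi> \<zeta> \<longleftrightarrow> star_representation \<pi> \<and>
     closed_cspan {\<pi> b \<cdot> \<zeta> | b. True} = UNIV \<and> (\<forall>b. \<mu> \<cdot> b = cinner \<zeta> (\<pi> b \<cdot> \<zeta>))"

text \<open>
  \<open>J\<close> is the antiunitary factor and \<open>P\<close> the positive factor of the polar decomposition of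
  \<open>\<pi> b \<zeta> \<mapsto> \<pi> (star b) \<zeta>\<close>. For a finite-dimensional algebra this map is everywhere defined and
  invertible, so \<open>P\<close> is bounded and both factors are uniquely determined by their product.
\<close>

definition modular_conj ::
  "('n::cstar_algebra \<Rightarrow> ('m::chilbert_space, 'm) cblin) \<Rightarrow> 'm \<Rightarrow> 'm \<Rightarrow> 'm" where
  "modular_conj \<pi> \<zeta> = (THE J. antiunitary J \<and>
     (\<exists>P. positive_op P \<and> (\<forall>b. J (P \<cdot> \<pi> b \<cdot> \<zeta>) = \<pi> (star b) \<cdot> \<zeta>)))"

definition op_rep ::
  "('n::cstar_algebra \<Rightarrow> ('m::chilbert_space, 'm) cblin) \<Rightarrow> 'm \<Rightarrow> 'n opp \<Rightarrow> ('m, 'm) cblin" where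
  "op_rep \<pi> \<zeta> b = cblin_of
     (\<lambda>x. modular_conj \<pi> \<zeta> (adj (\<pi> (unop b)) \<cdot> modular_conj \<pi> \<zeta> x))"


section \<open>C*-bases and C*-factorizations\<close>

definition cstar_subalgebra :: "('h::chilbert_space, 'h) cblin set \<Rightarrow> bool" where
  "cstar_subalgebra B \<longleftrightarrow> csubspace B \<and> closed B \<and>
     (\<forall>x\<in>B. \<forall>y\<in>B. x o\<^sub>C y \<in> B) \<and> (\<forall>x\<in>B. adj x \<in> B)"

definition nondegenerate_alg :: "('h::chilbert_space, 'h) cblin set \<Rightarrow> bool" where
  "nondegenerate_alg B \<longleftrightarrow> closed_cspan {b \<cdot> x | b x. b \<in> B} = UNIV"

definition cstar_base ::
  "('h::chilbert_space, 'h) cblin set \<Rightarrow> ('h, 'h) cblin set \<Rightarrow> bool" where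
  "cstar_base B B' \<longleftrightarrow> cstar_subalgebra B \<and> cstar_subalgebra B' \<and>
     nondegenerate_alg B \<and> nondegenerate_alg B' \<and> (\<forall>b\<in>B. \<forall>b'\<in>B'. b o\<^sub>C b' = b' o\<^sub>C b)"

definition cyclic_vector :: "('h::chilbert_space, 'h) cblin set \<Rightarrow> 'h \<Rightarrow> bool" where
  "cyclic_vector B \<zeta> \<longleftrightarrow> closed_cspan {b \<cdot> \<zeta> | b. b \<in> B} = UNIV"

definition bicyclic_vector ::
  "('h::chilbert_space, 'h) cblin set \<Rightarrow> ('h, 'h) cblin set \<Rightarrow> 'h \<Rightarrow> bool" where
  "bicyclic_vector B B' \<zeta> \<longleftrightarrow> cyclic_vector B \<zeta> \<and> cyclic_vector B' \<zeta>"

text \<open>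
  For a C*-base \<open>(\<HH>, B, B')\<close>, the factorizations with respect to it are described by \<open>B\<close> alone,
  those with respect to \<open>(\<HH>, B', B)\<close> by \<open>B'\<close> alone.
\<close>

definition cstar_factorization ::
  "('b::chilbert_space, 'b) cblin set \<Rightarrow> ('b, 'h::chilbert_space) cblin set \<Rightarrow> bool" where
  "cstar_factorization B \<alpha> \<longleftrightarrow> csubspace \<alpha> \<and> closed \<alpha> \<and>
     closed_cspan {adj \<xi> o\<^sub>C \<xi>' | \<xi> \<xi>'. \<xi> \<in> \<alpha> \<and> \<xi>' \<in> \<alpha>} = B \<and>
     closed_cspan {\<xi> o\<^sub>C b | \<xi> b. \<xi> \<in> \<alpha> \<and> b \<in> B} = \<alpha> \<and>
     closed_cspan {\<xi> \<cdot> \<omega> | \<xi> \<omega>. \<xi> \<in> \<alpha>} = UNIV"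

definition factorization_rep ::
  "('b::chilbert_space, 'h::chilbert_space) cblin set \<Rightarrow> ('b, 'b) cblin \<Rightarrow> ('h, 'h) cblin" where
  "factorization_rep \<alpha> b = (THE T. \<forall>\<xi>\<in>\<alpha>. \<forall>\<omega>. T \<cdot> \<xi> \<cdot> \<omega> = \<xi> \<cdot> b \<cdot> \<omega>)"


section \<open>The algebraic tensor product of complex vector spaces\<close>

inductive_set tensor_null :: "(('a::complex_vector \<times> 'b::complex_vector) \<Rightarrow>\<^sub>0 complex) set" where
  zero: "0 \<in> tensor_null"
| plus: "u \<in> tensor_null \<Longrightarrow> v \<in> tensor_null \<Longrightarrow> u + v \<in> tensor_null"
| add_left: "Poly_Mapping.single (x + x', y) c - Poly_Mapping.single (x, y) c
    - Poly_Mapping.single (x', y) c \<in> tensor_null"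
| add_right: "Poly_Mapping.single (x, y + y') c - Poly_Mapping.single (x, y) c
    - Poly_Mapping.single (x, y') c \<in> tensor_null"
| scale_left: "Poly_Mapping.single (d *\<^sub>C x, y) c - Poly_Mapping.single (x, y) (c * d) \<in> tensor_null"
| scale_right: "Poly_Mapping.single (x, d *\<^sub>C y) c - Poly_Mapping.single (x, y) (c * d) \<in> tensor_null"

definition poly_scale :: "complex \<Rightarrow> ('a \<Rightarrow>\<^sub>0 complex) \<Rightarrow> ('a \<Rightarrow>\<^sub>0 complex)" where
  "poly_scale c = Poly_Mapping.map ((*) c)"

lemma lookup_poly_scale: "Poly_Mapping.lookup (poly_scale c u) k = c * Poly_Mapping.lookup u k"
  by (simp add: poly_scale_def Poly_Mapping.map.rep_eq when_def)

lemma poly_scale_single: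
  "poly_scale c (Poly_Mapping.single k d) = Poly_Mapping.single k (c * d)"
  by (rule poly_mapping_eqI) (simp add: lookup_poly_scale lookup_single when_def)

lemma poly_scale_add: "poly_scale c (u + v) = poly_scale c u + poly_scale c v"
  by (rule poly_mapping_eqI) (simp add: lookup_poly_scale lookup_add distrib_left)

lemma poly_scale_diff: "poly_scale c (u - v) = poly_scale c u - poly_scale c v"
  by (rule poly_mapping_eqI) (simp add: lookup_poly_scale lookup_minus right_diff_distrib)

lemma poly_scale_zero: "poly_scale c 0 = 0"
  by (rule poly_mapping_eqI) (simp add: lookup_poly_scale)

lemma tensor_null_scale: "u \<in> tensor_null \<Longrightarrow> poly_scale c u \<in> tensor_null"
proof (induction rule: tensor_null.induct)
  case (scale_left d x y e)
  then show ?case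
    using tensor_null.scale_left[of d x y "c * e"]
    by (simp add: poly_scale_diff poly_scale_single mult.assoc)
next
  case (scale_right x d y e)
  then show ?case
    using tensor_null.scale_right[of x d y "c * e"]
    by (simp add: poly_scale_diff poly_scale_single mult.assoc)
qed (simp_all add: poly_scale_zero poly_scale_add poly_scale_diff poly_scale_single
    tensor_null.zero tensor_null.plus tensor_null.add_left tensor_null.add_right)

lemma tensor_null_uminus: "u \<in> tensor_null \<Longrightarrow> - u \<in> tensor_null"
proof -
  have "- u = poly_scale (- 1) u"
    by (rule poly_mapping_eqI) (simp add: lookup_poly_scale)
  then show "u \<in> tensor_null \<Longrightarrow> - u \<in> tensor_null"
    by (simp add: tensor_null_scale)
qed

quotient_type (overloaded) ('a, 'b) tensor =
  "('a::complex_vector \<times> 'b::complex_vector) \<Rightarrow>\<^sub>0 complex" / "\<lambda>u v. u - v \<in> tensor_null"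
proof (rule equivpI)
  show "reflp (\<lambda>u v. u - v \<in> (tensor_null :: (('a \<times> 'b) \<Rightarrow>\<^sub>0 complex) set))"
    by (simp add: reflp_def tensor_null.zero)
  show "symp (\<lambda>u v. u - v \<in> (tensor_null :: (('a \<times> 'b) \<Rightarrow>\<^sub>0 complex) set))"
    using tensor_null_uminus by (fastforce simp: symp_def)
  show "transp (\<lambda>u v. u - v \<in> (tensor_null :: (('a \<times> 'b) \<Rightarrow>\<^sub>0 complex) set))"
    using tensor_null.plus by (fastforce simp: transp_def)
qed

lift_definition tensor_of :: "'a::complex_vector \<Rightarrow> 'b::complex_vector \<Rightarrow> ('a, 'b) tensor"
    (infixl \<open>\<otimes>\<close> 70)
  is "\<lambda>x y. Poly_Mapping.single (x, y) 1" .

instantiation tensor :: (complex_vector, complex_vector) complex_vector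
begin

lift_definition zero_tensor :: "('a, 'b) tensor" is 0 .
lift_definition plus_tensor :: "('a, 'b) tensor \<Rightarrow> ('a, 'b) tensor \<Rightarrow> ('a, 'b) tensor" is "(+)"
  using tensor_null.plus by (fastforce simp: algebra_simps)
lift_definition uminus_tensor :: "('a, 'b) tensor \<Rightarrow> ('a, 'b) tensor" is uminus
  using tensor_null_uminus by fastforce
definition minus_tensor :: "('a, 'b) tensor \<Rightarrow> ('a, 'b) tensor \<Rightarrow> ('a, 'b) tensor" where
  "minus_tensor u v = u + - v"
lift_definition scaleC_tensor :: "complex \<Rightarrow> ('a, 'b) tensor \<Rightarrow> ('a, 'b) tensor" is poly_scale
  by (simp add: tensor_null_scale flip: poly_scale_diff)
definition scaleR_tensor :: "real \<Rightarrow> ('a, 'b) tensor \<Rightarrow> ('a, 'b) tensor" where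
  "scaleR_tensor r u = complex_of_real r *\<^sub>C u"

instance
proof
  fix x y z :: "('a, 'b) tensor" and r s :: real and c d :: complex
  show "x + y + z = x + (y + z)" by transfer (simp add: add.assoc tensor_null.zero)
  show "x + y = y + x" by transfer (simp add: tensor_null.zero)
  show "0 + x = x" by transfer (simp add: tensor_null.zero)
  show "- x + x = 0" by transfer (simp add: tensor_null.zero)
  show "x - y = x + - y" by (rule minus_tensor_def)
  show add_right: "c *\<^sub>C (x + y) = c *\<^sub>C x + c *\<^sub>C y" for c
    by transfer (simp add: tensor_null.zero poly_scale_add)
  show add_left: "(c + d) *\<^sub>C x = c *\<^sub>C x + d *\<^sub>C x" for c d
  proof transfer
    fix c d and x :: "('a \<times> 'b) \<Rightarrow>\<^sub>0 complex"
    have "poly_scale (c + d) x = poly_scale c x + poly_scale d x"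
      by (rule poly_mapping_eqI) (simp add: lookup_poly_scale lookup_add distrib_right)
    then show "poly_scale (c + d) x - (poly_scale c x + poly_scale d x) \<in> tensor_null"
      by (simp add: tensor_null.zero)
  qed
  show scale: "c *\<^sub>C d *\<^sub>C x = (c * d) *\<^sub>C x" for c d
  proof transfer
    fix c d and x :: "('a \<times> 'b) \<Rightarrow>\<^sub>0 complex"
    have "poly_scale c (poly_scale d x) = poly_scale (c * d) x"
      by (rule poly_mapping_eqI) (simp add: lookup_poly_scale)
    then show "poly_scale c (poly_scale d x) - poly_scale (c * d) x \<in> tensor_null"
      by (simp add: tensor_null.zero)
  qed
  show one: "1 *\<^sub>C x = x"
  proof transfer
    fix x :: "('a \<times> 'b) \<Rightarrow>\<^sub>0 complex"
    have "poly_scale 1 x = x"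
      by (rule poly_mapping_eqI) (simp add: lookup_poly_scale)
    then show "poly_scale 1 x - x \<in> tensor_null"
      by (simp add: tensor_null.zero)
  qed
  show "r *\<^sub>R (x + y) = r *\<^sub>R x + r *\<^sub>R y"
    by (simp add: scaleR_tensor_def add_right)
  show "(r + s) *\<^sub>R x = r *\<^sub>R x + s *\<^sub>R x"
    by (simp add: scaleR_tensor_def add_left)
  show "r *\<^sub>R s *\<^sub>R x = (r * s) *\<^sub>R x"
    by (simp add: scaleR_tensor_def scale)
  show "1 *\<^sub>R x = x"
    by (simp add: scaleR_tensor_def one)
  show "r *\<^sub>R x = complex_of_real r *\<^sub>C x"
    by (rule scaleR_tensor_def)
qed

end


section \<open>Separation and completion\<close>

text \<open>
  The relative tensor products are quotients that depend on operators and not only on types, so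
  they are carried by sets. The form is conjugate-linear in its first argument.
\<close>

record 'a form_space =
  points :: "'a set"
  vadd :: "'a \<Rightarrow> 'a \<Rightarrow> 'a"
  vscale :: "complex \<Rightarrow> 'a \<Rightarrow> 'a"
  form :: "'a \<Rightarrow> 'a \<Rightarrow> complex"

definition seminorm_dist :: "'a form_space \<Rightarrow> 'a \<Rightarrow> 'a \<Rightarrow> real" where
  "seminorm_dist S v w =
     (let d = vadd S v (vscale S (- 1) w) in sqrt (Re (form S d d)))"

definition sep_class :: "'a form_space \<Rightarrow> 'a \<Rightarrow> 'a set" where
  "sep_class S v = {w \<in> points S. seminorm_dist S v w = 0}"

definition rep :: "'a set \<Rightarrow> 'a" where
  "rep X = (SOME x. x \<in> X)"

definition separation :: "'a form_space \<Rightarrow> 'a set form_space" where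
  "separation S =
     \<lparr>points = sep_class S ` points S,
      vadd = (\<lambda>X Y. sep_class S (vadd S (rep X) (rep Y))),
      vscale = (\<lambda>c X. sep_class S (vscale S c (rep X))),
      form = (\<lambda>X Y. form S (rep X) (rep Y))\<rparr>"

definition cauchy_space :: "'a form_space \<Rightarrow> (nat \<Rightarrow> 'a) form_space" where
  "cauchy_space S =
     \<lparr>points = {X. (\<forall>n. X n \<in> points S) \<and>
        (\<forall>e>0. \<exists>M. \<forall>m\<ge>M. \<forall>n\<ge>M. seminorm_dist S (X m) (X n) < e)},
      vadd = (\<lambda>X Y n. vadd S (X n) (Y n)),
      vscale = (\<lambda>c X n. vscale S c (X n)),
      form = (\<lambda>X Y. lim (\<lambda>n. form S (X n) (Y n)))\<rparr>"

text \<open>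
  Two Cauchy sequences get identified when the seminorm of their difference tends to 0, so
  this separates and completes at the same time.
\<close>

definition sep_completion :: "'a form_space \<Rightarrow> (nat \<Rightarrow> 'a) set form_space" where
  "sep_completion S = separation (cauchy_space S)"

definition sep_completion_class :: "'a form_space \<Rightarrow> 'a \<Rightarrow> (nat \<Rightarrow> 'a) set" where
  "sep_completion_class S v = sep_class (cauchy_space S) (\<lambda>n. v)"

definition unitary_map :: "'a form_space \<Rightarrow> 'b form_space \<Rightarrow> ('a \<Rightarrow> 'b) \<Rightarrow> bool" where
  "unitary_map S T \<Phi> \<longleftrightarrow> bij_betw \<Phi> (points S) (points T) \<and>
     (\<forall>x\<in>points S. \<forall>y\<in>points S. \<Phi> (vadd S x y) = vadd T (\<Phi> x) (\<Phi> y)) \<and>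
     (\<forall>c. \<forall>x\<in>points S. \<Phi> (vscale S c x) = vscale T c (\<Phi> x)) \<and>
     (\<forall>x\<in>points S. \<forall>y\<in>points S. form T (\<Phi> x) (\<Phi> y) = form S x y)"

definition sesquilinear :: "('a::complex_vector \<Rightarrow> 'a \<Rightarrow> complex) \<Rightarrow> bool" where
  "sesquilinear f \<longleftrightarrow>
     (\<forall>x y z. f (x + y) z = f x z + f y z) \<and> (\<forall>x y z. f x (y + z) = f x y + f x z) \<and>
     (\<forall>c x y. f (c *\<^sub>C x) y = cnj c * f x y) \<and> (\<forall>c x y. f x (c *\<^sub>C y) = c * f x y)"


section \<open>The relative tensor product\<close>

text \<open>
  This gives \<open>R\<^sup>\<rho>(\<xi>)\<close> with \<open>\<pi>\<close> the opposite GNS representation, and \<open>R\<^sup>\<sigma>(\<eta>)\<close> with \<open>\<pi>\<close> the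
  GNS representation itself.
\<close>

definition R_op ::
  "('n \<Rightarrow> ('m::chilbert_space, 'm) cblin) \<Rightarrow> 'm \<Rightarrow>
   ('n \<Rightarrow> ('h::chilbert_space, 'h) cblin) \<Rightarrow> 'h \<Rightarrow> ('m, 'h) cblin" where
  "R_op \<pi> \<zeta> \<rho> \<xi> = (THE T. \<forall>b. T \<cdot> \<pi> b \<cdot> \<zeta> = \<rho> b \<cdot> \<xi>)"

definition rel_form ::
  "('n::cstar_algebra \<Rightarrow> ('m::chilbert_space, 'm) cblin) \<Rightarrow> 'm \<Rightarrow>
   ('n opp \<Rightarrow> ('h::chilbert_space, 'h) cblin) \<Rightarrow> ('n \<Rightarrow> ('k::chilbert_space, 'k) cblin) \<Rightarrow>
   ('h, 'k) tensor \<Rightarrow> ('h, 'k) tensor \<Rightarrow> complex" where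
  "rel_form \<pi> \<zeta> \<rho> \<sigma> = (THE f. sesquilinear f \<and>
     (\<forall>\<xi> \<eta> \<xi>' \<eta>'. f (\<xi> \<otimes> \<eta>) (\<xi>' \<otimes> \<eta>') =
        cinner (adj (R_op (op_rep \<pi> \<zeta>) \<zeta> \<rho> \<xi>') \<cdot> R_op (op_rep \<pi> \<zeta>) \<zeta> \<rho> \<xi> \<cdot> \<zeta>)
               (adj (R_op \<pi> \<zeta> \<sigma> \<eta>) \<cdot> R_op \<pi> \<zeta> \<sigma> \<eta>' \<cdot> \<zeta>)))"

definition rel_form_space ::
  "('n::cstar_algebra \<Rightarrow> ('m::chilbert_space, 'm) cblin) \<Rightarrow> 'm \<Rightarrow>
   ('n opp \<Rightarrow> ('h::chilbert_space, 'h) cblin) \<Rightarrow> ('n \<Rightarrow> ('k::chilbert_space, 'k) cblin) \<Rightarrow>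
   ('h, 'k) tensor form_space" where
  "rel_form_space \<pi> \<zeta> \<rho> \<sigma> =
     \<lparr>points = UNIV, vadd = (+), vscale = scaleC, form = rel_form \<pi> \<zeta> \<rho> \<sigma>\<rparr>"

definition rel_tensor ::
  "('n::cstar_algebra \<Rightarrow> ('m::chilbert_space, 'm) cblin) \<Rightarrow> 'm \<Rightarrow>
   ('n opp \<Rightarrow> ('h::chilbert_space, 'h) cblin) \<Rightarrow> ('n \<Rightarrow> ('k::chilbert_space, 'k) cblin) \<Rightarrow>
   ('h, 'k) tensor set form_space" where
  "rel_tensor \<pi> \<zeta> \<rho> \<sigma> = separation (rel_form_space \<pi> \<zeta> \<rho> \<sigma>)"

definition rel_elem ::
  "('n::cstar_algebra \<Rightarrow> ('m::chilbert_space, 'm) cblin) \<Rightarrow> 'm \<Rightarrow>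
   ('n opp \<Rightarrow> ('h::chilbert_space, 'h) cblin) \<Rightarrow> ('n \<Rightarrow> ('k::chilbert_space, 'k) cblin) \<Rightarrow>
   'h \<Rightarrow> 'k \<Rightarrow> ('h, 'k) tensor set" where
  "rel_elem \<pi> \<zeta> \<rho> \<sigma> \<xi> \<eta> = sep_class (rel_form_space \<pi> \<zeta> \<rho> \<sigma>) (\<xi> \<otimes> \<eta>)"


section \<open>The C*-relative tensor product\<close>

type_synonym ('b, 'h, 'k) tensor3 = "((('b, 'h) cblin, 'b) tensor, ('b, 'k) cblin) tensor"

definition cstar_rel_form ::
  "('b::chilbert_space, 'h::chilbert_space, 'k::chilbert_space) tensor3 \<Rightarrow>
   ('b, 'h, 'k) tensor3 \<Rightarrow> complex" where
  "cstar_rel_form = (THE f. sesquilinear f \<and>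
     (\<forall>\<xi> \<omega> \<eta> \<xi>' \<omega>' \<eta>'. f (\<xi> \<otimes> \<omega> \<otimes> \<eta>) (\<xi>' \<otimes> \<omega>' \<otimes> \<eta>') =
        cinner \<omega> ((adj \<xi> o\<^sub>C \<xi>') \<cdot> (adj \<eta> o\<^sub>C \<eta>') \<cdot> \<omega>')))"

text \<open>
  The algebraic tensor product of \<open>\<alpha>\<close>, \<open>\<HH>\<close> and \<open>\<beta>\<close> is the span of its elementary tensors in the
  tensor product of the ambient spaces (over a field, the tensor product of subspaces embeds).
  On the latter the form is still defined, but in general neither hermitian nor positive.
\<close>

definition cstar_rel_form_space ::
  "('b::chilbert_space, 'h::chilbert_space) cblin set \<Rightarrow> ('b, 'k::chilbert_space) cblin set \<Rightarrow>
   ('b, 'h, 'k) tensor3 form_space" where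
  "cstar_rel_form_space \<alpha> \<beta> =
     \<lparr>points = cspan {\<xi> \<otimes> \<omega> \<otimes> \<eta> | \<xi> \<omega> \<eta>. \<xi> \<in> \<alpha> \<and> \<eta> \<in> \<beta>},
      vadd = (+), vscale = scaleC, form = cstar_rel_form\<rparr>"

definition cstar_rel_tensor ::
  "('b::chilbert_space, 'h::chilbert_space) cblin set \<Rightarrow> ('b, 'k::chilbert_space) cblin set \<Rightarrow>
   (nat \<Rightarrow> ('b, 'h, 'k) tensor3) set form_space" where
  "cstar_rel_tensor \<alpha> \<beta> = sep_completion (cstar_rel_form_space \<alpha> \<beta>)"

definition cstar_rel_elem ::
  "('b::chilbert_space, 'h::chilbert_space) cblin set \<Rightarrow> ('b, 'k::chilbert_space) cblin set \<Rightarrow>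
   ('b, 'h) cblin \<Rightarrow> 'b \<Rightarrow> ('b, 'k) cblin \<Rightarrow> (nat \<Rightarrow> ('b, 'h, 'k) tensor3) set" where
  "cstar_rel_elem \<alpha> \<beta> \<xi> \<omega> \<eta> = sep_completion_class (cstar_rel_form_space \<alpha> \<beta>) (\<xi> \<otimes> \<omega> \<otimes> \<eta>)"

end

theory Submission
  imports Defs "HOL-Library.Function_Algebras"
begin

text \<open>
  Write \<open>H\<close> and \<open>K\<close> for the spaces with factorizations \<open>\<alpha>\<close> and \<open>\<beta>\<close>. The bicyclic vector turns the
  factorizations into copies of these spaces: \<open>a \<mapsto> a \<zeta>\<close> is a linear bijection from \<open>\<alpha>\<close> onto \<open>H\<close>.
  It is injective because \<open>\<zeta>\<close> is cyclic for \<open>B'\<close>, and surjective because \<open>\<zeta>\<close> is cyclic for \<open>B\<close>. Its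
  inverse is \<open>\<xi> \<mapsto> R(\<xi>) U\<close>, as \<open>R(a \<zeta>)\<close> and \<open>a U\<^sup>*\<close> both send \<open>U b' \<zeta>\<close> to \<open>a b' \<zeta>\<close> for \<open>b' \<in> B'\<close>
  (lemma \<open>R_op_eq\<close>). The same holds for \<open>\<beta>\<close> and \<open>K\<close> with \<open>B\<close> and \<open>B'\<close> interchanged. The only fact
  about the opposite GNS representation that enters is that its range corresponds to \<open>B'\<close>.

  Hence there is a linear map from the algebraic tensor product of \<open>H\<close> and \<open>K\<close> to that of \<open>\<alpha>\<close>, the
  base space and \<open>\<beta>\<close>, which sends \<open>a \<zeta> \<otimes> c \<zeta>\<close> to \<open>a \<otimes> \<zeta> \<otimes> c\<close>. It is isometric, since the two
  forms take the same values \<open>\<langle>a'\<^sup>* a \<zeta> | c\<^sup>* c' \<zeta>\<rangle> = \<langle>\<zeta> | a\<^sup>* a' c\<^sup>* c' \<zeta>\<rangle>\<close> (lemma \<open>rel_form_eq\<close>), and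
  its range is dense, since \<open>\<xi> \<otimes> b \<zeta> \<otimes> \<eta>\<close> and \<open>\<xi> b \<otimes> \<zeta> \<otimes> \<eta>\<close> differ by a null vector (lemma
  \<open>fuse_dense\<close>). Such a map induces a unitary of the separated completions; the first space is
  already complete, being finite-dimensional (lemma \<open>unitary_separation_completion\<close>).

  What needs work is that the form of the C*-relative tensor product is positive, that is, that
  \<open>\<Sum>\<^sub>i\<^sub>j \<langle>\<omega>\<^sub>i | \<xi>\<^sub>i\<^sup>* \<xi>\<^sub>j \<eta>\<^sub>i\<^sup>* \<eta>\<^sub>j \<omega>\<^sub>j\<rangle> \<ge> 0\<close>. The Gram matrices \<open>(\<xi>\<^sub>i\<^sup>* \<xi>\<^sub>j)\<close> and \<open>(\<eta>\<^sub>i\<^sup>* \<eta>\<^sub>j)\<close> are positive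
  and the entries of one commute with those of the other; their Schur product is a compression of a product of two
  commuting positive operators (lemma \<open>schur_product_positive\<close>). That such a product is positive is
  proved by the decomposition of Riesz and Nagy into a series of squares, which requires no
  functional calculus (lemma \<open>commuting_positive\<close>).
\<close>

section \<open>Semi-inner products\<close>

lemma minus_as_scaleC: "x + (- 1) *\<^sub>C y = x - (y :: 'a::complex_vector)"
  by (simp add: complex_vector.scale_minus_left scaleC_one)

text \<open>
  A positive semidefinite Hermitian form, conjugate-linear in the first argument. It is sesquilinear
  on the whole type, but Hermitian and positive only on the subspace \<open>V\<close>: the form defining the
  C*-relative tensor product lives on a larger space than the one on which it is positive.
\<close>

locale semi_inner =
  fixes V :: "'a::complex_vector set" and g :: "'a \<Rightarrow> 'a \<Rightarrow> complex"
  assumes subspace: "csubspace V"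
    and sesquilinear: "sesquilinear g"
    and hermitian: "x \<in> V \<Longrightarrow> y \<in> V \<Longrightarrow> g x y = cnj (g y x)"
    and nonneg: "x \<in> V \<Longrightarrow> 0 \<le> Re (g x x)"

lemma sesquilinear_simps:
  assumes "sesquilinear g"
  shows "g (x + y) z = g x z + g y z" "g x (y + z) = g x y + g x z"
    "g (c *\<^sub>C x) y = cnj c * g x y" "g x (c *\<^sub>C y) = c * g x y"
    "g 0 x = 0" "g x 0 = 0" "g (x - y) z = g x z - g y z" "g x (y - z) = g x y - g x z"
    "g (\<Sum>i\<in>I. a i) x = (\<Sum>i\<in>I. g (a i) x)" "g x (\<Sum>i\<in>I. a i) = (\<Sum>i\<in>I. g x (a i))"
proof -
  show add: "g (x + y) z = g x z + g y z" "g x (y + z) = g x y + g x z"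
    and scale: "g (c *\<^sub>C x) y = cnj c * g x y" "g x (c *\<^sub>C y) = c * g x y" for x y z c
    using assms by (auto simp: sesquilinear_def)
  show zero: "g 0 x = 0" "g x 0 = 0" for x
    using scale(1)[of 0 0 x] scale(2)[of x 0 0] by simp_all
  show "g (x - y) z = g x z - g y z" "g x (y - z) = g x y - g x z"
    using add(1)[of "x - y" y z] add(2)[of x "y - z" z] by simp_all
  show "g (\<Sum>i\<in>I. a i) x = (\<Sum>i\<in>I. g (a i) x)"
    by (induction I rule: infinite_finite_induct) (simp_all add: add zero)
  show "g x (\<Sum>i\<in>I. a i) = (\<Sum>i\<in>I. g x (a i))"
    by (induction I rule: infinite_finite_induct) (simp_all add: add zero)
qed

context semi_inner
begin

lemmas g_simps = sesquilinear_simps[OF sesquilinear]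

lemma in_add: "x \<in> V \<Longrightarrow> y \<in> V \<Longrightarrow> x + y \<in> V"
  and in_diff: "x \<in> V \<Longrightarrow> y \<in> V \<Longrightarrow> x - y \<in> V"
  and in_scale: "x \<in> V \<Longrightarrow> c *\<^sub>C x \<in> V"
  and in_zero: "0 \<in> V"
  using subspace
  by (auto intro: complex_vector.subspace_add complex_vector.subspace_diff
      complex_vector.subspace_scale complex_vector.subspace_0)

lemma in_sum: "(\<And>i. i \<in> I \<Longrightarrow> a i \<in> V) \<Longrightarrow> (\<Sum>i\<in>I. a i) \<in> V"
  by (rule complex_vector.subspace_sum[OF subspace])

text \<open>The seminorm of the form.\<close>

definition N :: "'a \<Rightarrow> real" where "N x = sqrt (Re (g x x))"

lemma N_nonneg: "x \<in> V \<Longrightarrow> 0 \<le> N x"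
  by (simp add: N_def nonneg)

lemma N_power2: "x \<in> V \<Longrightarrow> (N x)\<^sup>2 = Re (g x x)"
  by (simp add: N_def nonneg)

lemma self_real: "x \<in> V \<Longrightarrow> g x x = of_real ((N x)\<^sup>2)"
  using hermitian[of x x] by (simp add: complex_eq_iff N_power2)

lemma N_scaleC: "x \<in> V \<Longrightarrow> N (c *\<^sub>C x) = cmod c * N x"
proof -
  assume "x \<in> V"
  have "g (c *\<^sub>C x) (c *\<^sub>C x) = of_real ((cmod c)\<^sup>2) * g x x"
    using complex_norm_square[of c] by (simp add: g_simps)
  then have "Re (g (c *\<^sub>C x) (c *\<^sub>C x)) = (cmod c)\<^sup>2 * Re (g x x)" by simp
  then show ?thesis by (simp add: N_def real_sqrt_mult)
qed

lemma N_zero: "N 0 = 0" by (simp add: N_def g_simps)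

lemma N_minus_commute: "x \<in> V \<Longrightarrow> y \<in> V \<Longrightarrow> N (x - y) = N (y - x)"
  using N_scaleC[OF in_diff, of x y "-1"]
  by (simp add: complex_vector.scale_minus_left scaleC_one)

lemma cauchy_schwarz:
  assumes x: "x \<in> V" and y: "y \<in> V"
  shows "cmod (g x y) \<le> N x * N y"
proof -
  define b where "b = cmod (g x y)"
  \<comment> \<open>Positivity at \<open>x + s y\<close>, with the phase of \<open>s\<close> aligned to \<open>g x y\<close>, is a real quadratic in \<open>t\<close>.\<close>
  have quad: "0 \<le> (N x)\<^sup>2 + 2 * t * b\<^sup>2 + t\<^sup>2 * b\<^sup>2 * (N y)\<^sup>2" for t :: real
  proof -
    define s where "s = of_real t * cnj (g x y)"
    have yx: "g y x = cnj (g x y)" using hermitian[OF y x] .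
    have n: "cnj z * z = of_real ((cmod z)\<^sup>2)" for z
      by (metis complex_norm_square mult.commute)
    have "g (x + s *\<^sub>C y) (x + s *\<^sub>C y) =
        g x x + s * g x y + cnj s * g y x + cnj s * s * g y y"
      by (simp add: g_simps algebra_simps)
    also have "s * g x y = of_real (t * b\<^sup>2)"
      by (simp add: s_def b_def mult.assoc n)
    also have "cnj s * g y x = of_real (t * b\<^sup>2)"
      using n[of "g x y"] by (simp add: s_def b_def yx mult.assoc) (simp add: mult_ac)
    also have "cnj s * s = of_real (t\<^sup>2 * b\<^sup>2)"
      unfolding n by (simp add: s_def b_def norm_mult power_mult_distrib)
    finally have "Re (g (x + s *\<^sub>C y) (x + s *\<^sub>C y)) =
        (N x)\<^sup>2 + 2 * t * b\<^sup>2 + t\<^sup>2 * b\<^sup>2 * (N y)\<^sup>2"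
      by (simp add: self_real x y)
    then show ?thesis using nonneg[of "x + s *\<^sub>C y"] x y by (simp add: in_add in_scale)
  qed
  have "b\<^sup>2 \<le> (N x * N y)\<^sup>2"
  proof (cases "N y = 0")
    case True
    have "b = 0"
    proof (rule ccontr)
      assume b: "b \<noteq> 0"
      show False
        using quad[of "- ((N x)\<^sup>2 + 1) / (2 * b\<^sup>2)"] b True by (simp add: field_simps)
    qed
    then show ?thesis by simp
  next
    case False
    define c where "c = (N y)\<^sup>2"
    have "0 < c" using False by (simp add: c_def)
    then show ?thesis
      using quad[of "- 1 / c"] unfolding power_mult_distrib c_def[symmetric]
      by (simp add: field_simps power2_eq_square)
  qed
  then show ?thesis
    by (metis b_def N_nonneg x y mult_nonneg_nonneg power2_le_imp_le)
qed

lemma N_triangle: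
  assumes x: "x \<in> V" and y: "y \<in> V"
  shows "N (x + y) \<le> N x + N y"
proof -
  have "(N (x + y))\<^sup>2 = (N x)\<^sup>2 + (Re (g x y) + Re (g y x)) + (N y)\<^sup>2"
    using x y by (simp add: N_power2 in_add g_simps)
  also have "\<dots> \<le> (N x)\<^sup>2 + (N x * N y + N y * N x) + (N y)\<^sup>2"
    using cauchy_schwarz[OF x y] cauchy_schwarz[OF y x]
      complex_Re_le_cmod[of "g x y"] complex_Re_le_cmod[of "g y x"] by linarith
  finally have "(N (x + y))\<^sup>2 \<le> (N x + N y)\<^sup>2" by (simp add: power2_eq_square algebra_simps)
  then show ?thesis by (rule power2_le_imp_le) (simp add: N_nonneg x y)
qed

lemma N_triangle_diff:
  "x \<in> V \<Longrightarrow> y \<in> V \<Longrightarrow> z \<in> V \<Longrightarrow> N (x - z) \<le> N (x - y) + N (y - z)"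
  using N_triangle[of "x - y" "y - z"] by (simp add: in_diff)

lemma null_form:
  assumes "x \<in> V" "y \<in> V" "N x = 0" shows "g x y = 0" "g y x = 0"
  using cauchy_schwarz[of x y] cauchy_schwarz[of y x] assms by auto

text \<open>
  Orthonormalization modulo null vectors: vectors of seminorm 0 are dropped, so the resulting
  expansion holds only up to a null vector.
\<close>

lemma gram_schmidt:
  assumes "finite F" "F \<subseteq> V"
  shows "\<exists>E. finite E \<and> E \<subseteq> cspan F \<and> (\<forall>e\<in>E. \<forall>e'\<in>E. g e e' = (if e = e' then 1 else 0)) \<and>
    (\<forall>v\<in>cspan F. N (v - (\<Sum>e\<in>E. g e v *\<^sub>C e)) = 0)"
  using assms
proof (induction F rule: finite_induct)
  case empty
  show ?case by (rule exI[of _ "{}"]) (simp add: N_zero)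
next
  case (insert x F)
  then obtain E where E: "finite E" "E \<subseteq> cspan F"
      "\<forall>e\<in>E. \<forall>e'\<in>E. g e e' = (if e = e' then 1 else 0)"
      "\<forall>v\<in>cspan F. N (v - (\<Sum>e\<in>E. g e v *\<^sub>C e)) = 0" by auto
  have spanV: "cspan F \<subseteq> V"
    using insert.prems by (intro complex_vector.span_minimal subspace) auto
  have xV: "x \<in> V" using insert.prems by auto
  have EV: "e \<in> V" if "e \<in> E" for e using E(2) spanV that by blast
  have mono: "cspan F \<subseteq> cspan (insert x F)" by (rule complex_vector.span_mono) auto
  have xs: "x \<in> cspan (insert x F)" by (rule complex_vector.span_base) auto
  \<comment> \<open>The vectors whose remainder is null form a subspace, so generators suffice.\<close>
  have lift: "\<forall>v\<in>cspan (insert x F). N (v - (\<Sum>e\<in>E'. g e v *\<^sub>C e)) = 0"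
    if E': "finite E'" "E' \<subseteq> V" and g: "\<And>v. v \<in> insert x F \<Longrightarrow> N (v - (\<Sum>e\<in>E'. g e v *\<^sub>C e)) = 0" for E'
  proof -
    let ?R = "\<lambda>v. v - (\<Sum>e\<in>E'. g e v *\<^sub>C e)"
    have R: "?R v \<in> V" if "v \<in> V" for v using E' that by (auto intro!: in_diff in_sum in_scale)
    have "csubspace {v \<in> V. N (?R v) = 0}"
    proof (rule complex_vector.subspaceI)
      show "0 \<in> {v \<in> V. N (?R v) = 0}" by (simp add: in_zero N_zero g_simps)
    next
      fix u v assume uv: "u \<in> {v \<in> V. N (?R v) = 0}" "v \<in> {v \<in> V. N (?R v) = 0}"
      have Radd: "?R (u + v) = ?R u + ?R v"
        by (simp add: g_simps scaleC_add_left sum.distrib)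
      have "N (?R (u + v)) \<le> 0"
        unfolding Radd using N_triangle[OF R R, of u v] uv by simp
      then have "N (?R (u + v)) = 0" using N_nonneg[OF R, of "u + v"] uv in_add by force
      then show "u + v \<in> {v \<in> V. N (?R v) = 0}" using uv in_add by auto
    next
      fix c v assume v: "v \<in> {v \<in> V. N (?R v) = 0}"
      have "?R (c *\<^sub>C v) = c *\<^sub>C ?R v"
        by (simp add: g_simps complex_vector.scale_right_diff_distrib complex_vector.scale_sum_right scaleC_scaleC)
      then show "c *\<^sub>C v \<in> {v \<in> V. N (?R v) = 0}" using v in_scale N_scaleC[OF R, of v] by auto
    qed
    then have "cspan (insert x F) \<subseteq> {v \<in> V. N (?R v) = 0}"
      using g insert.prems by (intro complex_vector.span_minimal) auto
    then show ?thesis by auto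
  qed
  define r where "r = x - (\<Sum>e\<in>E. g e x *\<^sub>C e)"
  have rs: "r \<in> cspan (insert x F)"
    unfolding r_def using E mono xs
    by (auto intro!: complex_vector.span_diff complex_vector.span_sum complex_vector.span_scale)
  have rV: "r \<in> V" unfolding r_def using xV EV by (auto intro!: in_diff in_sum in_scale)
  have er: "g e r = 0" if "e \<in> E" for e
  proof -
    have "g e (\<Sum>e'\<in>E. g e' x *\<^sub>C e') = (\<Sum>e'\<in>E. if e' = e then g e x else 0)"
      unfolding g_simps using E(3) that by (intro sum.cong) auto
    then show ?thesis using E(1) that by (simp add: r_def g_simps)
  qed
  show ?case
  proof (cases "N r = 0")
    case True
    show ?thesis
    proof (intro exI[of _ E] conjI lift)
      fix v assume "v \<in> insert x F"
      then show "N (v - (\<Sum>e\<in>E. g e v *\<^sub>C e)) = 0"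
        using True E(4) complex_vector.span_base[of v F] by (auto simp: r_def)
    qed (use E mono EV in auto)
  next
    case False
    define e' where "e' = of_real (1 / N r) *\<^sub>C r"
    have e'V: "e' \<in> V" by (simp add: e'_def rV in_scale)
    have ee': "g e e' = 0" "g e' e = 0" if "e \<in> E" for e
    proof -
      show "g e e' = 0" by (simp add: e'_def g_simps er that)
      then show "g e' e = 0" using hermitian[OF e'V EV[OF that]] by simp
    qed
    have e'r: "g e' r = of_real (N r)"
      using False by (simp add: e'_def g_simps self_real rV power2_eq_square)
    have e'e': "g e' e' = 1"
      using e'r False by (subst (2) e'_def) (simp add: g_simps)
    have notin: "e' \<notin> E" using ee' e'e' by force
    have e'x: "g e' x = of_real (N r)"
    proof -
      have "g e' x = g e' r + g e' (\<Sum>e\<in>E. g e x *\<^sub>C e)" by (simp add: r_def g_simps)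
      also have "g e' (\<Sum>e\<in>E. g e x *\<^sub>C e) = 0" by (simp add: g_simps ee')
      finally show ?thesis by (simp add: e'r)
    qed
    show ?thesis
    proof (intro exI[of _ "insert e' E"] conjI lift)
      show "finite (insert e' E)" "finite (insert e' E)" by (simp_all add: E)
      show "insert e' E \<subseteq> V" using EV e'V by auto
      show "insert e' E \<subseteq> cspan (insert x F)"
        using E(2) mono rs by (auto simp: e'_def complex_vector.span_scale)
      show "\<forall>e\<in>insert e' E. \<forall>e''\<in>insert e' E. g e e'' = (if e = e'' then 1 else 0)"
        using E(3) ee' e'e' notin by auto
      fix v assume v: "v \<in> insert x F"
      have split: "v - (\<Sum>e\<in>insert e' E. g e v *\<^sub>C e) = (v - (\<Sum>e\<in>E. g e v *\<^sub>C e)) - g e' v *\<^sub>C e'"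
        using E(1) notin by (simp add: algebra_simps)
      show "N (v - (\<Sum>e\<in>insert e' E. g e v *\<^sub>C e)) = 0"
      proof (cases "v = x")
        case True
        have "g e' x *\<^sub>C e' = r" using False unfolding e'x by (simp add: e'_def)
        then show ?thesis using split True by (simp add: r_def[symmetric] N_zero)
      next
        case False
        then have vF: "v \<in> cspan F" using v complex_vector.span_base by blast
        then have vV: "v \<in> V" using spanV by auto
        have n: "N (v - (\<Sum>e\<in>E. g e v *\<^sub>C e)) = 0" using E(4) vF by auto
        have "g e' v = g e' (v - (\<Sum>e\<in>E. g e v *\<^sub>C e)) + g e' (\<Sum>e\<in>E. g e v *\<^sub>C e)"
          by (simp add: g_simps)
        also have "g e' (\<Sum>e\<in>E. g e v *\<^sub>C e) = 0" by (simp add: g_simps ee')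
        also have "g e' (v - (\<Sum>e\<in>E. g e v *\<^sub>C e)) = 0"
          using vV EV by (intro null_form(2)[OF _ e'V n]) (auto intro!: in_diff in_sum in_scale)
        finally show ?thesis unfolding split using n by simp
      qed
    qed
  qed
qed

text \<open>A finite-dimensional semi-inner product space is complete for its seminorm.\<close>

lemma complete:
  assumes F: "finite F" "V = cspan F" and X: "\<And>n. X n \<in> V"
    and cau: "\<And>\<epsilon>. \<epsilon> > 0 \<Longrightarrow> \<exists>M. \<forall>m\<ge>M. \<forall>n\<ge>M. N (X m - X n) < \<epsilon>"
  shows "\<exists>l\<in>V. (\<lambda>n. N (X n - l)) \<longlonglongrightarrow> 0"
proof -
  have "F \<subseteq> V" unfolding F(2) by (rule complex_vector.span_superset)
  from gram_schmidt[OF F(1) this] obtain E where E: "finite E" "E \<subseteq> V"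
      "\<forall>e\<in>E. \<forall>e'\<in>E. g e e' = (if e = e' then 1 else 0)"
      "\<And>v. v \<in> V \<Longrightarrow> N (v - (\<Sum>e\<in>E. g e v *\<^sub>C e)) = 0"
    unfolding F(2)[symmetric] by blast
  have Ne: "N e = 1" if "e \<in> E" for e using E(3) that by (simp add: N_def)
  have "\<exists>c. (\<lambda>n. g e (X n)) \<longlonglongrightarrow> c" if e: "e \<in> E" for e
  proof -
    have "Cauchy (\<lambda>n. g e (X n))"
    proof (rule metric_CauchyI)
      fix \<epsilon> :: real assume "\<epsilon> > 0"
      then obtain M where M: "\<forall>m\<ge>M. \<forall>n\<ge>M. N (X m - X n) < \<epsilon>" using cau by blast
      have "dist (g e (X m)) (g e (X n)) \<le> N (X m - X n)" for m n
        using cauchy_schwarz[OF subsetD[OF E(2) e] in_diff[OF X X], of m n] Ne[OF e]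
        by (simp add: dist_norm g_simps)
      then show "\<exists>M. \<forall>m\<ge>M. \<forall>n\<ge>M. dist (g e (X m)) (g e (X n)) < \<epsilon>"
        using M by (meson order.strict_trans1)
    qed
    then show ?thesis using Cauchy_convergent convergent_def by blast
  qed
  then obtain c where c: "\<And>e. e \<in> E \<Longrightarrow> (\<lambda>n. g e (X n)) \<longlonglongrightarrow> c e" by metis
  define l where "l = (\<Sum>e\<in>E. c e *\<^sub>C e)"
  have lV: "l \<in> V" unfolding l_def using E(2) by (auto intro!: in_sum in_scale)
  have sumV: "(\<Sum>e\<in>E. k e *\<^sub>C e) \<in> V" for k using E(2) by (auto intro!: in_sum in_scale)
  have Nsum: "N (\<Sum>e\<in>E. k e *\<^sub>C e) \<le> (\<Sum>e\<in>E. cmod (k e))" for k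
    using \<open>finite E\<close> E(2) Ne
  proof (induction E rule: finite_induct)
    case (insert x A)
    have A: "(\<Sum>e\<in>A. k e *\<^sub>C e) \<in> V" and x: "x \<in> V" "N x = 1"
      using insert.prems by (auto intro!: in_sum in_scale)
    have "N (\<Sum>e\<in>A. k e *\<^sub>C e) \<le> (\<Sum>e\<in>A. cmod (k e))"
      using insert.IH insert.prems by blast
    then show ?case
      using insert.hyps N_triangle[OF in_scale[OF x(1)] A, of "k x"] N_scaleC[OF x(1), of "k x"] x(2)
      by simp
  qed (simp add: N_zero)
  have bound: "N (X n - l) \<le> (\<Sum>e\<in>E. cmod (g e (X n) - c e))" for n
  proof -
    have "N (X n - l) \<le> N (X n - (\<Sum>e\<in>E. g e (X n) *\<^sub>C e)) + N ((\<Sum>e\<in>E. g e (X n) *\<^sub>C e) - l)"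
      by (rule N_triangle_diff) (auto simp: X lV sumV)
    also have "N (X n - (\<Sum>e\<in>E. g e (X n) *\<^sub>C e)) = 0" by (simp add: E(4) X)
    also have "(\<Sum>e\<in>E. g e (X n) *\<^sub>C e) - l = (\<Sum>e\<in>E. (g e (X n) - c e) *\<^sub>C e)"
      by (simp add: l_def complex_vector.scale_left_diff_distrib sum_subtractf)
    finally show ?thesis using Nsum[of "\<lambda>e. g e (X n) - c e"] by simp
  qed
  have "(\<lambda>n. \<Sum>e\<in>E. cmod (g e (X n) - c e)) \<longlonglongrightarrow> 0"
  proof (rule tendsto_null_sum)
    fix e assume "e \<in> E"
    then have "(\<lambda>n. g e (X n) - c e) \<longlonglongrightarrow> 0" using c LIM_zero by blast
    then show "(\<lambda>n. cmod (g e (X n) - c e)) \<longlonglongrightarrow> 0" by (rule tendsto_norm_zero)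
  qed
  then have "(\<lambda>n. N (X n - l)) \<longlonglongrightarrow> 0"
    by (rule real_tendsto_sandwich[OF always_eventually always_eventually tendsto_const, rotated 2])
       (simp_all add: bound N_nonneg X lV in_diff)
  then show ?thesis using lV by blast
qed

end

section \<open>Products of commuting positive operators\<close>

text \<open>
  The argument of Riesz and Nagy, which avoids square roots. For \<open>0 \<le> Q \<le> 1\<close> put \<open>q 0 = Q\<close> and
  \<open>q (n + 1) = q n - (q n)\<^sup>2\<close>; all \<open>q n\<close> lie between 0 and 1, and \<open>Q\<close> is the sum of the squares
  \<open>(q k)\<^sup>2\<close> for \<open>k < n\<close> plus the remainder \<open>q n\<close>. At every vector the remainder tends to 0 in
  seminorm, so \<open>P Q\<close> is the limit of the sums of the positive operators \<open>q k P q k\<close>.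
\<close>

lemma (in semi_inner) commuting_positive:
  assumes V: "V = UNIV"
    and P: "\<And>x y. P (x + y) = P x + P y" "\<And>x y. g (P x) y = g x (P y)" "\<And>x. 0 \<le> Re (g (P x) x)"
    and Q: "\<And>x y. Q (x + y) = Q x + Q y" "\<And>x y. g (Q x) y = g x (Q y)" "\<And>x. 0 \<le> Re (g (Q x) x)"
      "\<And>x. Re (g (Q x) x) \<le> Re (g x x)"
    and PQ: "\<And>x. P (Q x) = Q (P x)"
  shows "0 \<le> Re (g (P (Q x)) x)"
proof -
  note gp = nonneg[unfolded V, OF UNIV_I]
  define q where "q = rec_nat Q (\<lambda>n A x. A x - A (A x))"
  have q0: "q 0 = Q" and qS: "q (Suc n) x = q n x - q n (q n x)" for n x
    by (simp_all add: q_def)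
  have diff: "A (x - y) = A x - A y" if "\<And>x y. A (x + y) = A x + A y" for A :: "'a \<Rightarrow> 'a" and x y
    using that[of "x - y" y] by simp
  have q: "(\<forall>x y. q n (x + y) = q n x + q n y) \<and> (\<forall>x y. g (q n x) y = g x (q n y)) \<and>
     (\<forall>x. 0 \<le> Re (g (q n x) x) \<and> Re (g (q n x) x) \<le> Re (g x x)) \<and> (\<forall>x. P (q n x) = q n (P x))" for n
  proof (induction n)
    case 0
    then show ?case using Q PQ by (simp add: q0)
  next
    case (Suc n)
    define A where "A = q n"
    have A: "A (x + y) = A x + A y" "g (A x) y = g x (A y)" "0 \<le> Re (g (A x) x)"
      "Re (g (A x) x) \<le> Re (g x x)" "P (A x) = A (P x)" for x y
      using Suc by (auto simp: A_def)
    note Ad = diff[of A, OF A(1)]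
    \<comment> \<open>\<open>A - A\<^sup>2 = A (1 - A) A + (1 - A) A (1 - A)\<close>\<close>
    have "0 \<le> Re (g (A x - A (A x)) x)" for x
    proof -
      have "0 \<le> (Re (g (A x) (A x)) - Re (g (A (A x)) (A x))) + Re (g (A (x - A x)) (x - A x))"
        using A(3)[of "x - A x"] A(4)[of "A x"] by simp
      also have "\<dots> = Re (g (A x - A (A x)) x)"
        by (simp add: g_simps Ad A(2))
      finally show ?thesis .
    qed
    moreover have "Re (g (A x - A (A x)) x) \<le> Re (g x x)" for x
      using A(4)[of x] gp[of "A x"] by (simp add: g_simps A(2))
    ultimately show ?case
      by (simp add: qS flip: A_def) (simp add: A(1,5) Ad g_simps A(2) diff[of P, OF P(1)])
  qed
  have telescope: "Re (g (P (Q x)) x) = (\<Sum>k<n. Re (g (P (q k x)) (q k x))) + Re (g (P (q n x)) x)" for n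
  proof (induction n)
    case (Suc n)
    have "g (P (q n (q n x))) x = g (P (q n x)) (q n x)" using q[of n] by metis
    then show ?case using Suc by (simp add: qS diff[of P, OF P(1)] g_simps)
  qed (simp add: q0)
  have sum: "Re (g (Q x) x) = (\<Sum>k<n. Re (g (q k x) (q k x))) + Re (g (q n x) x)" for n
  proof (induction n)
    case (Suc n)
    have "g (q n (q n x)) x = g (q n x) (q n x)" using q[of n] by metis
    then show ?case using Suc by (simp add: qS g_simps)
  qed (simp add: q0)
  have "summable (\<lambda>k. Re (g (q k x) (q k x)))"
  proof (rule summableI_nonneg_bounded)
    show "(\<Sum>k<n. Re (g (q k x) (q k x))) \<le> Re (g (Q x) x)" for n
      using sum[of n] q[of n] by (metis le_add_same_cancel1)
  qed (rule gp)
  then have "(\<lambda>k. Re (g (q k x) (q k x))) \<longlonglongrightarrow> 0" by (rule summable_LIMSEQ_zero)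
  then have "(\<lambda>k. N (q k x)) \<longlonglongrightarrow> 0"
    unfolding N_def using tendsto_real_sqrt by force
  then have lim: "(\<lambda>k. - (N (q k x) * N (P x))) \<longlonglongrightarrow> 0"
    by (intro tendsto_eq_intros | simp)+
  have "- (N (q k x) * N (P x)) \<le> Re (g (P (Q x)) x)" for k
  proof -
    have "0 \<le> (\<Sum>k<k. Re (g (P (q k x)) (q k x)))" by (intro sum_nonneg P(3))
    moreover have "\<bar>Re (g (P (q k x)) x)\<bar> \<le> N (q k x) * N (P x)"
      using cauchy_schwarz[of "q k x" "P x"] abs_Re_le_cmod[of "g (q k x) (P x)"]
      by (simp add: V P(2))
    ultimately show ?thesis using telescope[of k] by linarith
  qed
  then show ?thesis using lim by (intro LIMSEQ_le_const2) auto
qed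

lemma (in semi_inner) commuting_positive_bounded:
  assumes V: "V = UNIV"
    and P: "\<And>x y. P (x + y) = P x + P y" "\<And>c x. P (c *\<^sub>C x) = c *\<^sub>C P x"
      "\<And>x y. g (P x) y = g x (P y)" "\<And>x. 0 \<le> Re (g (P x) x)"
    and Q: "\<And>x y. Q (x + y) = Q x + Q y" "\<And>x y. g (Q x) y = g x (Q y)" "\<And>x. 0 \<le> Re (g (Q x) x)"
      "\<And>x. Re (g (Q x) x) \<le> \<kappa> * Re (g x x)"
    and PQ: "\<And>x. P (Q x) = Q (P x)" and \<kappa>: "0 < \<kappa>"
  shows "0 \<le> Re (g (P (Q x)) x)"
proof -
  define c where "c = complex_of_real (1 / \<kappa>)"
  have c: "cnj c = c" "Re c = 1 / \<kappa>" "Im c = 0" by (simp_all add: c_def)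
  have "0 \<le> Re (g (P (c *\<^sub>C Q x)) x)"
    using \<kappa> by (intro commuting_positive[OF V P(1,3,4), where Q = "\<lambda>x. c *\<^sub>C Q x"])
      (simp_all add: Q(1-3) P(2) PQ scaleC_add_right g_simps c pos_divide_le_eq mult.commute Q(4)
        flip: Q(2))
  then show ?thesis using \<kappa> by (simp add: P(2) g_simps c zero_le_divide_iff)
qed

section \<open>Bounded operators\<close>

lemma cblin_eqI: "(\<And>x. S \<cdot> x = T \<cdot> x) \<Longrightarrow> S = T"
  by transfer (rule blinfun_eqI)

lemma cblin_compose_apply [simp]: "(S o\<^sub>C T) \<cdot> x = S \<cdot> T \<cdot> x"
  by transfer simp

lemma id_cblin_apply [simp]: "id_cblin \<cdot> x = x"
  by transfer simp

lemma cblin_add: "T \<cdot> (x + y) = T \<cdot> x + T \<cdot> y"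
  by transfer (simp add: blinfun.add_right)

lemma cblin_scaleC: "T \<cdot> (c *\<^sub>C x) = c *\<^sub>C (T \<cdot> x)"
  by transfer simp

lemma cblin_add_left: "(S + T) \<cdot> x = S \<cdot> x + T \<cdot> x"
  by transfer (simp add: blinfun.add_left)

lemma cblin_scaleC_left: "(c *\<^sub>C T) \<cdot> x = c *\<^sub>C (T \<cdot> x)"
  by transfer (simp add: bounded_linear_Blinfun_apply bounded_linear_scaleC blinfun.bounded_linear_right)

lemma cblin_norm: "norm (T \<cdot> x) \<le> norm T * norm x"
  by transfer (rule norm_blinfun)

lemma cblin_zero: "T \<cdot> 0 = 0"
  using cblin_add[of T 0 0] by simp

lemma cblin_zero_left: "0 \<cdot> x = 0"
  by transfer simp

lemma cblin_diff_left: "(S - T) \<cdot> x = S \<cdot> x - T \<cdot> x"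
  by transfer (simp add: blinfun.diff_left)

lemma cblin_sum: "T \<cdot> (\<Sum>i\<in>I. f i) = (\<Sum>i\<in>I. T \<cdot> f i)"
  by (induction I rule: infinite_finite_induct) (simp_all add: cblin_add cblin_zero)

lemma cblin_exists:
  fixes f :: "'a::complex_normed_vector \<Rightarrow> 'b::complex_normed_vector"
  assumes "\<And>x y. f (x + y) = f x + f y" "\<And>c x. f (c *\<^sub>C x) = c *\<^sub>C f x"
    and "\<And>x. norm (f x) \<le> K * norm x"
  shows "\<exists>T. \<forall>x. T \<cdot> x = f x"
proof -
  have "bounded_linear f"
    by (rule bounded_linear_intro[where K = K]) (simp_all add: assms scaleR_scaleC mult.commute)
  then have app: "blinfun_apply (Blinfun f) = f" by (rule bounded_linear_Blinfun_apply)
  then have "\<forall>x. cblin_apply (Abs_cblin (Blinfun f)) x = f x"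
    by (simp add: cblin_apply.rep_eq Abs_cblin_inverse assms)
  then show ?thesis by blast
qed

section \<open>Finite-dimensional Hilbert spaces\<close>

lemma sesquilinear_cinner: "sesquilinear (cinner :: 'a::complex_inner \<Rightarrow> _)"
  unfolding sesquilinear_def
proof (intro conjI allI)
  fix x y z :: 'a and c
  show "cinner (x + y) z = cinner x z + cinner y z"
    by (metis cinner_commute cinner_add_right complex_cnj_add)
  show "cinner (c *\<^sub>C x) y = cnj c * cinner x y"
    by (metis cinner_commute cinner_scaleC_right complex_cnj_mult)
qed (rule cinner_add_right cinner_scaleC_right)+

lemmas cinner_simps = sesquilinear_simps[OF sesquilinear_cinner]

interpretation cinner: semi_inner UNIV "cinner :: 'a::complex_inner \<Rightarrow> _"
  rewrites "semi_inner.N cinner = (norm :: 'a \<Rightarrow> real)"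
proof -
  show *: "semi_inner UNIV (cinner :: 'a \<Rightarrow> _)"
    by unfold_locales
      (simp_all add: sesquilinear_cinner complex_vector.subspace_UNIV cinner_ge_zero flip: cinner_commute)
  show "semi_inner.N cinner = (norm :: 'a \<Rightarrow> real)"
    by (rule ext) (simp add: semi_inner.N_def[OF *] norm_eq_sqrt_cinner)
qed

lemma cinner_extensionality:
  assumes "\<And>z. cinner z x = cinner z y" shows "x = y"
  using assms[of "x - y"] cinner_eq_zero_iff[of "x - y"] by (simp add: cinner_simps)

lemma orthonormal_basis:
  assumes "finite F"
  obtains E where "finite E" "E \<subseteq> cspan F" "\<And>v. v \<in> cspan F \<Longrightarrow> v = (\<Sum>e\<in>E. cinner e v *\<^sub>C e)"
  using cinner.gram_schmidt[of F] assms by auto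

lemma finite_dim_orthonormal_basis:
  assumes "cfinite_dim (UNIV :: 'a::complex_inner set)"
  obtains E where "finite E" "\<And>v :: 'a. (\<Sum>e\<in>E. cinner e v *\<^sub>C e) = v"
proof -
  obtain F :: "'a set" where F: "finite F" "cspan F = UNIV"
    using assms by (auto simp: cfinite_dim_def)
  show ?thesis
  proof (rule orthonormal_basis[OF F(1)])
    fix E assume "finite E" "\<And>v. v \<in> cspan F \<Longrightarrow> v = (\<Sum>e\<in>E. cinner e v *\<^sub>C e)"
    then show ?thesis using that F(2) by fastforce
  qed
qed

text \<open>
  Every subspace of a finite-dimensional space is closed: the orthogonal projection onto it is
  continuous and fixes it.
\<close>

lemma dense_csubspace:
  fixes V :: "'a::complex_inner set"
  assumes fin: "cfinite_dim (UNIV :: 'a set)" and V: "csubspace V" and dense: "closure V = UNIV"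
  shows "V = UNIV"
proof -
  obtain F :: "'a set" where F: "finite F" "cspan F = UNIV" using fin by (auto simp: cfinite_dim_def)
  obtain G where G: "G \<subseteq> V" "complex_vector.independent G" "V \<subseteq> cspan G"
    using complex_vector.maximal_independent_subset by blast
  have "finite G" using complex_vector.independent_span_bound[OF F(1) G(2)] F(2) by auto
  then obtain E where E: "finite E" "E \<subseteq> cspan G" "\<And>v. v \<in> cspan G \<Longrightarrow> v = (\<Sum>e\<in>E. cinner e v *\<^sub>C e)"
    by (rule orthonormal_basis) blast
  have "w \<in> V" for w
  proof -
    let ?R = "\<lambda>v. v - (\<Sum>e\<in>E. cinner e v *\<^sub>C e)"
    have "w \<in> closure V" using dense by simp
    then obtain s where s: "\<And>n. s n \<in> V" "s \<longlonglongrightarrow> w" unfolding closure_sequential by blast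
    have bound: "norm (?R w - ?R (s n)) \<le> (1 + (\<Sum>e\<in>E. norm e * norm e)) * norm (w - s n)" for n
    proof -
      have "?R w - ?R (s n) = (w - s n) - (\<Sum>e\<in>E. cinner e (w - s n) *\<^sub>C e)"
        by (simp add: cinner_simps complex_vector.scale_left_diff_distrib sum_subtractf)
      then have "norm (?R w - ?R (s n)) \<le> norm (w - s n) + norm (\<Sum>e\<in>E. cinner e (w - s n) *\<^sub>C e)"
        by (metis norm_triangle_ineq4)
      also have "norm (\<Sum>e\<in>E. cinner e (w - s n) *\<^sub>C e) \<le> (\<Sum>e\<in>E. (norm e * norm e) * norm (w - s n))"
      proof (rule sum_norm_le)
        fix e
        show "norm (cinner e (w - s n) *\<^sub>C e) \<le> (norm e * norm e) * norm (w - s n)"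
          using mult_right_mono[OF cinner.cauchy_schwarz[of e "w - s n"] norm_ge_zero[of e]]
          by (simp add: norm_scaleC mult_ac)
      qed
      finally show ?thesis by (simp add: distrib_right sum_distrib_right)
    qed
    have Rs: "?R (s n) = 0" for n using E(3)[of "s n"] s(1)[of n] G(3) by auto
    have "(\<lambda>n. (1 + (\<Sum>e\<in>E. norm e * norm e)) * norm (w - s n)) \<longlonglongrightarrow> (1 + (\<Sum>e\<in>E. norm e * norm e)) * norm (w - w)"
      by (intro tendsto_intros s(2))
    then have "norm (?R w) \<le> 0"
      using bound by (intro LIMSEQ_le_const[of _ 0]) (auto simp: Rs)
    then have "w = (\<Sum>e\<in>E. cinner e w *\<^sub>C e)" by simp
    also have "\<dots> \<in> V"
      using E(2) complex_vector.span_minimal[OF G(1) V]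
      by (intro complex_vector.subspace_sum[OF V] complex_vector.subspace_scale[OF V]) auto
    finally show ?thesis .
  qed
  then show ?thesis by blast
qed

lemma cspan_eq_UNIV:
  fixes Y :: "'a::complex_inner set"
  assumes "cfinite_dim (UNIV :: 'a set)" "closed_cspan Y = UNIV"
  shows "cspan Y = UNIV"
  by (rule dense_csubspace[OF assms(1)]) (use assms in \<open>simp_all add: closed_cspan_def complex_vector.subspace_span\<close>)

lemma finite_dim_cblin_exists:
  fixes f :: "'a::complex_inner \<Rightarrow> 'b::complex_normed_vector"
  assumes fin: "cfinite_dim (UNIV :: 'a set)"
    and f: "\<And>x y. f (x + y) = f x + f y" "\<And>c x. f (c *\<^sub>C x) = c *\<^sub>C f x"
  shows "\<exists>T. \<forall>x. T \<cdot> x = f x"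
proof -
  obtain E where E: "finite E" "\<And>v :: 'a. (\<Sum>e\<in>E. cinner e v *\<^sub>C e) = v"
    using fin by (rule finite_dim_orthonormal_basis) blast
  have f0: "f 0 = 0" using f(1)[of 0 0] by simp
  have fsum: "f (\<Sum>e\<in>E. h e) = (\<Sum>e\<in>E. f (h e))" for h
    using E(1) by (induction E rule: finite_induct) (simp_all add: f f0)
  show ?thesis
  proof (rule cblin_exists[OF f])
    fix x
    have "norm (f x) = norm (\<Sum>e\<in>E. cinner e x *\<^sub>C f e)"
      by (subst E(2)[of x, symmetric]) (simp add: fsum f)
    also have "\<dots> \<le> (\<Sum>e\<in>E. (norm e * norm (f e)) * norm x)"
    proof (rule sum_norm_le)
      fix e
      show "norm (cinner e x *\<^sub>C f e) \<le> (norm e * norm (f e)) * norm x"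
        using mult_right_mono[OF cinner.cauchy_schwarz[of e x] norm_ge_zero[of "f e"]]
        by (simp add: norm_scaleC mult_ac)
    qed
    finally show "norm (f x) \<le> (\<Sum>e\<in>E. norm e * norm (f e)) * norm x"
      by (simp add: sum_distrib_right)
  qed
qed

section \<open>Adjoints\<close>

text \<open>
  The adjoint is a definite description. It is characterized by its defining property, which
  \<open>adj_eqI\<close> uses; that an adjoint exists is shown for operators with finite-dimensional domain, by
  means of an orthonormal basis.
\<close>

lemma adj_eqI:
  assumes "\<And>x y. cinner (S \<cdot> y) x = cinner y (T \<cdot> x)"
  shows "adj T = S"
  unfolding adj_def
proof (rule the_equality)
  fix S' assume "\<forall>x y. cinner (S' \<cdot> y) x = cinner y (T \<cdot> x)"
  then have "cinner (S' \<cdot> y) x = cinner (S \<cdot> y) x" for x y using assms by simp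
  then show "S' = S"
    by (metis cblin_eqI cinner_extensionality cinner_commute)
qed (use assms in blast)

lemma cinner_adj_left:
  fixes T :: "('a::chilbert_space, 'b::chilbert_space) cblin"
  assumes fin: "cfinite_dim (UNIV :: 'a set)"
  shows "cinner (adj T \<cdot> y) x = cinner y (T \<cdot> x)"
proof -
  obtain E where E: "finite E" "\<And>v :: 'a. (\<Sum>e\<in>E. cinner e v *\<^sub>C e) = v"
    using fin by (rule finite_dim_orthonormal_basis) blast
  define f where "f y = (\<Sum>e\<in>E. cinner (T \<cdot> e) y *\<^sub>C e)" for y
  have "\<exists>S. \<forall>y. S \<cdot> y = f y"
  proof (rule cblin_exists)
    fix y
    have "norm (f y) \<le> (\<Sum>e\<in>E. (norm (T \<cdot> e) * norm e) * norm y)"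
      unfolding f_def
    proof (rule sum_norm_le)
      fix e
      show "norm (cinner (T \<cdot> e) y *\<^sub>C e) \<le> (norm (T \<cdot> e) * norm e) * norm y"
        using mult_right_mono[OF cinner.cauchy_schwarz[of "T \<cdot> e" y] norm_ge_zero[of e]]
        by (simp add: norm_scaleC mult_ac)
    qed
    then show "norm (f y) \<le> (\<Sum>e\<in>E. norm (T \<cdot> e) * norm e) * norm y"
      by (simp add: sum_distrib_right)
  qed (simp_all add: f_def cinner_simps scaleC_add_left sum.distrib scaleC_scaleC
      complex_vector.scale_sum_right)
  then obtain S where S: "\<And>y. S \<cdot> y = f y" by blast
  have *: "cinner (S \<cdot> y) x = cinner y (T \<cdot> x)" for x y
  proof -
    have "cinner (S \<cdot> y) x = (\<Sum>e\<in>E. cinner y (T \<cdot> e) * cinner e x)"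
      by (simp add: S f_def cinner_simps flip: cinner_commute)
    also have "\<dots> = cinner y (T \<cdot> (\<Sum>e\<in>E. cinner e x *\<^sub>C e))"
      by (simp add: cblin_sum cblin_scaleC cinner_simps mult.commute)
    finally show ?thesis using E(2)[of x] by simp
  qed
  then show ?thesis using adj_eqI[of S T] by blast
qed

lemma cinner_adj_right:
  fixes T :: "('a::chilbert_space, 'b::chilbert_space) cblin"
  assumes "cfinite_dim (UNIV :: 'a set)"
  shows "cinner x (adj T \<cdot> y) = cinner (T \<cdot> x) y"
  by (metis assms cinner_adj_left cinner_commute)

lemma adj_adj:
  fixes T :: "('a::chilbert_space, 'b::chilbert_space) cblin"
  assumes "cfinite_dim (UNIV :: 'a set)"
  shows "adj (adj T) = T"
  by (rule adj_eqI) (simp add: cinner_adj_right assms)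

lemma adj_cblin_compose:
  fixes S :: "('b::chilbert_space, 'c::chilbert_space) cblin" and T :: "('a::chilbert_space, 'b) cblin"
  assumes "\<And>x y. cinner (adj S \<cdot> y) x = cinner y (S \<cdot> x)" "cfinite_dim (UNIV :: 'a set)"
  shows "adj (S o\<^sub>C T) = adj T o\<^sub>C adj S"
  by (rule adj_eqI) (simp add: cinner_adj_left assms)

lemma adj_add:
  fixes S T :: "('a::chilbert_space, 'b::chilbert_space) cblin"
  assumes "cfinite_dim (UNIV :: 'a set)"
  shows "adj (S + T) = adj S + adj T"
  by (rule adj_eqI) (simp add: cinner_adj_left[OF assms] cblin_add_left cinner_simps)

lemma adj_scaleC:
  fixes T :: "('a::chilbert_space, 'b::chilbert_space) cblin"
  assumes "cfinite_dim (UNIV :: 'a set)"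
  shows "adj (c *\<^sub>C T) = cnj c *\<^sub>C adj T"
  by (rule adj_eqI) (simp add: cinner_adj_left[OF assms] cblin_scaleC_left cinner_simps)

section \<open>Schur products of Gram matrices\<close>

text \<open>
  Functions form a vector space pointwise. Functions of two indices with values in a Hilbert space
  carry the matrices over operators.
\<close>

instantiation "fun" :: (type, real_vector) real_vector
begin
definition scaleR_fun :: "real \<Rightarrow> ('a \<Rightarrow> 'b) \<Rightarrow> 'a \<Rightarrow> 'b" where
  "scaleR_fun r f = (\<lambda>x. r *\<^sub>R f x)"
instance
  by standard (auto simp: scaleR_fun_def fun_eq_iff scaleR_add_right scaleR_add_left)
end

instantiation "fun" :: (type, complex_vector) complex_vector
begin
definition scaleC_fun :: "complex \<Rightarrow> ('a \<Rightarrow> 'b) \<Rightarrow> 'a \<Rightarrow> 'b" where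
  "scaleC_fun c f = (\<lambda>x. c *\<^sub>C f x)"
instance
  by standard (auto simp: scaleC_fun_def scaleR_fun_def fun_eq_iff scaleC_add_right scaleC_add_left
      scaleC_scaleC scaleC_one scaleR_scaleC)
end

text \<open>
  The Schur product of the Gram matrices of \<open>\<xi>\<close> and of \<open>\<eta>\<close> is positive if the entries of one
  commute with those of the other. On vectors \<open>x\<close> with two indices in \<open>I\<close>, let the first matrix act on the first index (\<open>P\<close>) and the
  second one on the second index (\<open>Q\<close>). These operators are positive and commute, so \<open>P Q\<close> is
  positive, and the Schur product is its compression to vectors supported on the diagonal.
\<close>

lemma schur_product_positive:
  fixes \<xi> :: "nat \<Rightarrow> ('b::chilbert_space, 'h::chilbert_space) cblin"
    and \<eta> :: "nat \<Rightarrow> ('b, 'k::chilbert_space) cblin" and \<omega> :: "nat \<Rightarrow> 'b"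
  assumes fin: "cfinite_dim (UNIV :: 'b set)" and I: "finite I"
    and comm: "\<And>i j k l x. adj (\<xi> i) \<cdot> \<xi> j \<cdot> adj (\<eta> k) \<cdot> \<eta> l \<cdot> x = adj (\<eta> k) \<cdot> \<eta> l \<cdot> adj (\<xi> i) \<cdot> \<xi> j \<cdot> x"
  shows "0 \<le> Re (\<Sum>i\<in>I. \<Sum>j\<in>I. cinner (\<omega> i) (adj (\<xi> i) \<cdot> \<xi> j \<cdot> adj (\<eta> i) \<cdot> \<eta> j \<cdot> \<omega> j))"
proof -
  define g where "g x y = (\<Sum>i\<in>I. \<Sum>l\<in>I. cinner (x i l) (y i l))" for x y :: "nat \<Rightarrow> nat \<Rightarrow> 'b"
  define S where "S x l = (\<Sum>j\<in>I. \<xi> j \<cdot> x j l)" for x :: "nat \<Rightarrow> nat \<Rightarrow> 'b" and l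
  define T where "T x i = (\<Sum>m\<in>I. \<eta> m \<cdot> x i m)" for x :: "nat \<Rightarrow> nat \<Rightarrow> 'b" and i
  define P where "P x = (\<lambda>i l. adj (\<xi> i) \<cdot> S x l)" for x
  define Q where "Q x = (\<lambda>i l. adj (\<eta> l) \<cdot> T x i)" for x
  have self: "Re (g x x) = (\<Sum>i\<in>I. \<Sum>l\<in>I. (norm (x i l))\<^sup>2)" for x
    by (simp add: g_def cinner.self_real)
  have sesq: "sesquilinear g"
    by (simp add: sesquilinear_def g_def cinner_simps scaleC_fun_def sum.distrib sum_distrib_left)
  interpret g: semi_inner UNIV g
  proof
    fix x y show "g x y = cnj (g y x)" by (simp add: g_def flip: cinner_commute)
    show "0 \<le> Re (g x x)" by (simp add: self sum_nonneg)
  qed (simp_all add: complex_vector.subspace_UNIV sesq)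
  have gP: "g (P x) y = (\<Sum>l\<in>I. cinner (S x l) (S y l))" for x y
    unfolding g_def P_def by (subst sum.swap) (simp add: S_def[of y] cinner_simps cinner_adj_left fin)
  have gP': "g x (P y) = (\<Sum>l\<in>I. cinner (S x l) (S y l))" for x y
    unfolding g_def P_def by (subst sum.swap) (simp add: S_def[of x] cinner_simps cinner_adj_right fin)
  have gQ: "g (Q x) y = (\<Sum>i\<in>I. cinner (T x i) (T y i))" for x y
    unfolding g_def Q_def by (simp add: T_def[of y] cinner_simps cinner_adj_left fin)
  have gQ': "g x (Q y) = (\<Sum>i\<in>I. cinner (T x i) (T y i))" for x y
    unfolding g_def Q_def by (simp add: T_def[of x] cinner_simps cinner_adj_right fin)
  \<comment> \<open>\<open>\<kappa>\<close> bounds \<open>Q\<close>; the summand 1 makes it positive.\<close>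
  define \<kappa> where "\<kappa> = (\<Sum>m\<in>I. (norm (\<eta> m))\<^sup>2) + 1"
  define x where "x i l = (if i = l then \<omega> i else 0)" for i l :: nat
  have bound: "(norm (T y i))\<^sup>2 \<le> \<kappa> * (\<Sum>l\<in>I. (norm (y i l))\<^sup>2)" for y i
  proof -
    have "norm (T y i) \<le> (\<Sum>m\<in>I. norm (\<eta> m) * norm (y i m))"
      unfolding T_def by (rule sum_norm_le) (rule cblin_norm)
    then have "(norm (T y i))\<^sup>2 \<le> (\<Sum>m\<in>I. norm (\<eta> m) * norm (y i m))\<^sup>2"
      by (simp add: power_mono)
    also have "\<dots> \<le> (\<Sum>m\<in>I. (norm (\<eta> m))\<^sup>2) * (\<Sum>m\<in>I. (norm (y i m))\<^sup>2)"
      by (rule Cauchy_Schwarz_ineq_sum)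
    also have "\<dots> \<le> \<kappa> * (\<Sum>m\<in>I. (norm (y i m))\<^sup>2)"
      by (intro mult_right_mono) (simp_all add: \<kappa>_def sum_nonneg)
    finally show ?thesis .
  qed
  have "0 \<le> Re (g (P (Q x)) x)"
  proof (rule g.commuting_positive_bounded[where P = P and Q = Q and \<kappa> = \<kappa>])
    fix y z :: "nat \<Rightarrow> nat \<Rightarrow> 'b" and c
    show "P (y + z) = P y + P z" "Q (y + z) = Q y + Q z" "P (c *\<^sub>C y) = c *\<^sub>C P y"
      by (simp_all add: P_def S_def Q_def T_def fun_eq_iff cblin_add cblin_scaleC scaleC_fun_def
          sum.distrib flip: complex_vector.scale_sum_right)
    show "P (Q y) = Q (P y)"
    proof (intro ext)
      fix i l
      have "P (Q y) i l = (\<Sum>j\<in>I. \<Sum>m\<in>I. adj (\<eta> l) \<cdot> \<eta> m \<cdot> adj (\<xi> i) \<cdot> \<xi> j \<cdot> y j m)"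
        by (simp add: P_def S_def Q_def T_def cblin_sum comm)
      also have "\<dots> = Q (P y) i l"
        by (subst sum.swap) (simp add: P_def S_def Q_def T_def cblin_sum)
      finally show "P (Q y) i l = Q (P y) i l" .
    qed
    show "g (P y) z = g y (P z)" "g (Q y) z = g y (Q z)"
      by (simp_all add: gP gP' gQ gQ')
    show "0 \<le> Re (g (P y) y)" "0 \<le> Re (g (Q y) y)"
      by (simp_all add: gP gQ sum_nonneg cinner_ge_zero)
    show "Re (g (Q y) y) \<le> \<kappa> * Re (g y y)"
      using sum_mono[of I, OF bound]
      by (simp add: gQ self cinner.self_real sum_distrib_left)
  qed (simp_all add: \<kappa>_def sum_nonneg add_nonneg_pos)
  also have "g (P (Q x)) x = (\<Sum>l\<in>I. \<Sum>j\<in>I. cinner (\<xi> j \<cdot> adj (\<eta> l) \<cdot> \<eta> j \<cdot> \<omega> j) (\<xi> l \<cdot> \<omega> l))"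
  proof -
    have pick: "(\<Sum>j\<in>I. A j \<cdot> (if j = l then \<omega> j else 0)) = A l \<cdot> \<omega> l"
      "(\<Sum>j\<in>I. A j \<cdot> (if l = j then \<omega> l else 0)) = A l \<cdot> \<omega> l"
      if "l \<in> I" for l and A :: "nat \<Rightarrow> ('b, 'c::complex_normed_vector) cblin"
    proof -
      have "(\<Sum>j\<in>I. A j \<cdot> (if j = l then \<omega> j else 0)) = (\<Sum>j\<in>I. if j = l then A l \<cdot> \<omega> l else 0)"
        by (rule sum.cong) (simp_all add: cblin_zero)
      then show "(\<Sum>j\<in>I. A j \<cdot> (if j = l then \<omega> j else 0)) = A l \<cdot> \<omega> l"
        using that I by simp
      then show "(\<Sum>j\<in>I. A j \<cdot> (if l = j then \<omega> l else 0)) = A l \<cdot> \<omega> l"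
        by (simp add: eq_commute[of l] if_distrib cong: if_cong)
    qed
    have S: "S x l = \<xi> l \<cdot> \<omega> l" and T: "T x l = \<eta> l \<cdot> \<omega> l" if "l \<in> I" for l
      using that by (simp_all add: S_def T_def x_def pick)
    have "S (Q x) l = (\<Sum>j\<in>I. \<xi> j \<cdot> adj (\<eta> l) \<cdot> \<eta> j \<cdot> \<omega> j)" if "l \<in> I" for l
      by (simp add: S_def Q_def T)
    then show ?thesis by (simp add: gP S cinner_simps)
  qed
  also have "Re \<dots> = Re (\<Sum>i\<in>I. \<Sum>j\<in>I. cinner (\<omega> i) (adj (\<xi> i) \<cdot> \<xi> j \<cdot> adj (\<eta> i) \<cdot> \<eta> j \<cdot> \<omega> j))"
  proof -
    have "Re (cinner a b) = Re (cinner b a)" for a b :: 'h by (subst cinner_commute) simp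
    then show ?thesis by (simp add: cinner_adj_right fin)
  qed
  finally show ?thesis .
qed

section \<open>Linear maps and forms on algebraic tensor products\<close>

definition cbilinear :: "('a::complex_vector \<Rightarrow> 'b::complex_vector \<Rightarrow> 'c::complex_vector) \<Rightarrow> bool" where
  "cbilinear \<phi> \<longleftrightarrow>
     (\<forall>x x' y. \<phi> (x + x') y = \<phi> x y + \<phi> x' y) \<and> (\<forall>x y y'. \<phi> x (y + y') = \<phi> x y + \<phi> x y') \<and>
     (\<forall>c x y. \<phi> (c *\<^sub>C x) y = c *\<^sub>C \<phi> x y) \<and> (\<forall>c x y. \<phi> x (c *\<^sub>C y) = c *\<^sub>C \<phi> x y)"

text \<open>The linear extension of \<open>\<phi>\<close> to formal linear combinations of pairs.\<close>

definition poly_ext ::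
  "('a \<Rightarrow> 'b \<Rightarrow> 'c::complex_vector) \<Rightarrow> (('a \<times> 'b) \<Rightarrow>\<^sub>0 complex) \<Rightarrow> 'c" where
  "poly_ext \<phi> u = (\<Sum>s\<in>Poly_Mapping.keys u. Poly_Mapping.lookup u s *\<^sub>C \<phi> (fst s) (snd s))"

lemma poly_ext_superset:
  "finite A \<Longrightarrow> Poly_Mapping.keys u \<subseteq> A \<Longrightarrow>
    poly_ext \<phi> u = (\<Sum>s\<in>A. Poly_Mapping.lookup u s *\<^sub>C \<phi> (fst s) (snd s))"
  unfolding poly_ext_def by (rule sum.mono_neutral_left) (auto simp: in_keys_iff)

lemma poly_ext_add: "poly_ext \<phi> (u + v) = poly_ext \<phi> u + poly_ext \<phi> v"
proof -
  let ?A = "Poly_Mapping.keys u \<union> Poly_Mapping.keys v"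
  have "poly_ext \<phi> w = (\<Sum>s\<in>?A. Poly_Mapping.lookup w s *\<^sub>C \<phi> (fst s) (snd s))"
    if "w \<in> {u, v, u + v}" for w
    using that keys_add[of u v] by (intro poly_ext_superset) auto
  then show ?thesis by (simp add: lookup_add scaleC_add_left sum.distrib)
qed

lemma poly_ext_scale: "poly_ext \<phi> (poly_scale c u) = c *\<^sub>C poly_ext \<phi> u"
proof -
  have "poly_ext \<phi> (poly_scale c u) =
      (\<Sum>s\<in>Poly_Mapping.keys u. Poly_Mapping.lookup (poly_scale c u) s *\<^sub>C \<phi> (fst s) (snd s))"
    by (rule poly_ext_superset) (auto simp: in_keys_iff lookup_poly_scale)
  then show ?thesis
    by (simp add: lookup_poly_scale poly_ext_def complex_vector.scale_sum_right)
qed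

lemma poly_ext_zero: "poly_ext \<phi> 0 = 0"
  by (simp add: poly_ext_def)

lemma poly_ext_diff: "poly_ext \<phi> (u - v) = poly_ext \<phi> u - poly_ext \<phi> v"
  using poly_ext_add[of \<phi> "u - v" v] by simp

lemma poly_ext_single: "poly_ext \<phi> (Poly_Mapping.single (x, y) c) = c *\<^sub>C \<phi> x y"
  by (subst poly_ext_superset[of "{(x, y)}"]) auto

lemma poly_ext_null:
  assumes "cbilinear \<phi>" shows "u \<in> tensor_null \<Longrightarrow> poly_ext \<phi> u = 0"
proof (induction rule: tensor_null.induct)
qed (use assms in \<open>simp_all add: cbilinear_def poly_ext_zero poly_ext_add poly_ext_diff poly_ext_single
      scaleC_add_right complex_vector.scale_scale\<close>)

text \<open>
  The linear map on the tensor product that a bilinear map \<open>\<phi>\<close> induces. For a map that is not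
  bilinear the value depends on the chosen representative. As the formula is linear in \<open>\<phi>\<close>, so is
  \<open>tensor_ext \<phi> t\<close>, without any assumption on \<open>\<phi>\<close>.
\<close>

definition tensor_ext ::
  "('a::complex_vector \<Rightarrow> 'b::complex_vector \<Rightarrow> 'c::complex_vector) \<Rightarrow> ('a, 'b) tensor \<Rightarrow> 'c" where
  "tensor_ext \<phi> t = poly_ext \<phi> (rep_tensor t)"

lemma tensor_ext_abs:
  assumes "cbilinear \<phi>" shows "tensor_ext \<phi> (abs_tensor u) = poly_ext \<phi> u"
proof -
  have "abs_tensor (rep_tensor (abs_tensor u)) = abs_tensor u"
    by (rule Quotient_abs_rep[OF Quotient_tensor])
  then have "rep_tensor (abs_tensor u) - u \<in> tensor_null"
    by (simp add: tensor.abs_eq_iff)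
  from poly_ext_null[OF assms this] show ?thesis by (simp add: tensor_ext_def poly_ext_diff)
qed

lemma tensor_ext_add: "cbilinear \<phi> \<Longrightarrow> tensor_ext \<phi> (s + t) = tensor_ext \<phi> s + tensor_ext \<phi> t"
proof (induction s rule: tensor.abs_induct, induction t rule: tensor.abs_induct)
  case (1 u v)
  then show ?case by (simp add: plus_tensor.abs_eq tensor_ext_abs poly_ext_add)
qed

lemma tensor_ext_scale: "cbilinear \<phi> \<Longrightarrow> tensor_ext \<phi> (c *\<^sub>C t) = c *\<^sub>C tensor_ext \<phi> t"
proof (induction t rule: tensor.abs_induct)
  case (1 u)
  then show ?case by (simp add: scaleC_tensor.abs_eq tensor_ext_abs poly_ext_scale)
qed

lemma tensor_ext_tensor: "cbilinear \<phi> \<Longrightarrow> tensor_ext \<phi> (x \<otimes> y) = \<phi> x y"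
  by (simp add: tensor_of.abs_eq tensor_ext_abs poly_ext_single)

lemma tensor_ext_fun_add: "tensor_ext (\<lambda>x y. \<phi> x y + \<psi> x y) t = tensor_ext \<phi> t + tensor_ext \<psi> t"
  by (simp add: tensor_ext_def poly_ext_def scaleC_add_right sum.distrib)

lemma tensor_ext_fun_scale: "tensor_ext (\<lambda>x y. c *\<^sub>C \<phi> x y) t = c *\<^sub>C tensor_ext \<phi> t"
  by (simp add: tensor_ext_def poly_ext_def complex_vector.scale_sum_right scaleC_scaleC mult.commute)

lemma tensor_add_left: "(x + x') \<otimes> y = x \<otimes> y + x' \<otimes> y"
  by transfer (use tensor_null.add_left[of _ _ _ 1] in \<open>simp add: algebra_simps\<close>)

lemma tensor_add_right: "x \<otimes> (y + y') = x \<otimes> y + x \<otimes> y'"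
  by transfer (use tensor_null.add_right[of _ _ _ 1] in \<open>simp add: algebra_simps\<close>)

lemma tensor_scale_left: "(c *\<^sub>C x) \<otimes> y = c *\<^sub>C (x \<otimes> y)"
  by transfer (use tensor_null.scale_left[of _ _ _ 1] in \<open>simp add: poly_scale_single\<close>)

lemma tensor_scale_right: "x \<otimes> (c *\<^sub>C y) = c *\<^sub>C (x \<otimes> y)"
  by transfer (use tensor_null.scale_right[of _ _ _ 1] in \<open>simp add: poly_scale_single\<close>)

lemma cbilinear_tensor: "cbilinear (\<otimes>)"
  by (simp add: cbilinear_def tensor_add_left tensor_add_right tensor_scale_left tensor_scale_right)

lemma cspan_tensor: "cspan {x \<otimes> y | x y. True} = (UNIV :: ('a::complex_vector, 'b::complex_vector) tensor set)"
proof -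
  have "abs_tensor u \<in> cspan {x \<otimes> y | x y. True}" for u :: "('a \<times> 'b) \<Rightarrow>\<^sub>0 complex"
  proof (induction u rule: update_induct)
    case const
    then show ?case by (simp add: zero_tensor.abs_eq[symmetric] complex_vector.span_zero)
  next
    case (update f k v)
    have "abs_tensor (Poly_Mapping.single k v) = v *\<^sub>C (fst k \<otimes> snd k)"
      by (simp add: tensor_of.abs_eq scaleC_tensor.abs_eq poly_scale_single)
    also have "\<dots> \<in> cspan {x \<otimes> y | x y. True}"
      by (intro complex_vector.span_scale complex_vector.span_base) auto
    finally have "abs_tensor (Poly_Mapping.single k v) \<in> cspan {x \<otimes> y | x y. True}" .
    moreover have "Poly_Mapping.update k v f = f + Poly_Mapping.single k v"
      using update.hyps
      by (intro poly_mapping_eqI) (auto simp: lookup_update lookup_add lookup_single in_keys_iff)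
    ultimately show ?case
      using update.IH by (simp add: plus_tensor.abs_eq[symmetric] complex_vector.span_add)
  qed
  then have "t \<in> cspan {x \<otimes> y | x y. True}" for t :: "('a, 'b) tensor"
    by (induction t rule: tensor.abs_induct)
  then show ?thesis by blast
qed

lemma cbilinear_sub:
  assumes "cbilinear \<phi>" "csubspace W"
  shows "csubspace {x. \<phi> x y \<in> W}" "csubspace {y. \<phi> x y \<in> W}"
proof -
  have "\<phi> 0 y = 0" "\<phi> x 0 = 0" for x y
    using assms(1) complex_vector.scale_zero_left unfolding cbilinear_def by metis+
  then show "csubspace {x. \<phi> x y \<in> W}" "csubspace {y. \<phi> x y \<in> W}"
    using assms unfolding cbilinear_def complex_vector.subspace_def by auto
qed

lemma tensor_in_cspan:
  assumes "x \<in> cspan X" "y \<in> cspan Y"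
  shows "x \<otimes> y \<in> cspan {x \<otimes> y | x y. x \<in> X \<and> y \<in> Y}"
proof -
  let ?W = "cspan {x \<otimes> y | x y. x \<in> X \<and> y \<in> Y}"
  have W: "csubspace ?W" by (rule complex_vector.subspace_span)
  have "cspan Y \<subseteq> {y. x \<otimes> y \<in> ?W}" if "x \<in> X" for x
    using that by (intro complex_vector.span_minimal cbilinear_sub[OF cbilinear_tensor W])
      (auto intro!: complex_vector.span_base)
  then have "cspan X \<subseteq> {x. x \<otimes> y \<in> ?W}"
    using assms(2) by (intro complex_vector.span_minimal cbilinear_sub[OF cbilinear_tensor W]) auto
  then show ?thesis using assms(1) by auto
qed

lemma cspan_tensor_spans:
  assumes "cspan X = UNIV" "cspan Y = UNIV"
  shows "cspan {x \<otimes> y | x y. x \<in> X \<and> y \<in> Y} = UNIV"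
proof -
  have "cspan {x \<otimes> y | x y. True} \<subseteq> cspan {x \<otimes> y | x y. x \<in> X \<and> y \<in> Y}"
    using tensor_in_cspan[of _ X _ Y] assms
    by (intro complex_vector.span_minimal complex_vector.subspace_span) auto
  then show ?thesis using cspan_tensor by auto
qed

lemma cfinite_dim_tensor:
  assumes "cfinite_dim (UNIV :: 'a::complex_vector set)" "cfinite_dim (UNIV :: 'b::complex_vector set)"
  shows "cfinite_dim (UNIV :: ('a, 'b) tensor set)"
proof -
  obtain X :: "'a set" and Y :: "'b set" where XY: "finite X" "cspan X = UNIV" "finite Y" "cspan Y = UNIV"
    using assms by (auto simp: cfinite_dim_def)
  have "{x \<otimes> y | x y. x \<in> X \<and> y \<in> Y} = (\<lambda>(x, y). x \<otimes> y) ` (X \<times> Y)" by auto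
  then have "finite {x \<otimes> y | x y. x \<in> X \<and> y \<in> Y}" using XY by simp
  then show ?thesis using cspan_tensor_spans[OF XY(2,4)] by (auto simp: cfinite_dim_def)
qed

lemma cspan_tensor3:
  "cspan {x \<otimes> y \<otimes> z | x y z. True} =
    (UNIV :: (('a::complex_vector, 'b::complex_vector) tensor, 'c::complex_vector) tensor set)"
proof -
  have "{x \<otimes> y \<otimes> z | (x :: 'a) (y :: 'b) (z :: 'c). True} =
      {p \<otimes> z | p z. p \<in> {x \<otimes> y | x y. True} \<and> z \<in> (UNIV :: 'c set)}"
    by blast
  then show ?thesis
    using cspan_tensor_spans[OF cspan_tensor complex_vector.span_UNIV] by simp
qed

lemma sesquilinear_unique:
  assumes f: "sesquilinear f" and f': "sesquilinear f'" and span: "cspan S = UNIV"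
    and eq: "\<And>x y. x \<in> S \<Longrightarrow> y \<in> S \<Longrightarrow> f x y = f' x y"
  shows "f = f'"
proof (intro ext)
  note simps = sesquilinear_simps[OF f] sesquilinear_simps[OF f']
  have "cspan S \<subseteq> {y. f x y = f' x y}" if "x \<in> S" for x
    using eq that by (intro complex_vector.span_minimal) (auto simp: complex_vector.subspace_def simps)
  then have "cspan S \<subseteq> {x. \<forall>y. f x y = f' x y}"
    using span by (intro complex_vector.span_minimal) (auto simp: complex_vector.subspace_def simps)
  then show "f x y = f' x y" for x y using span by auto
qed

text \<open>Trilinear forms and their linear extensions to threefold tensor products.\<close>

definition ctrilinear ::
  "('a::complex_vector \<Rightarrow> 'b::complex_vector \<Rightarrow> 'c::complex_vector \<Rightarrow> complex) \<Rightarrow> bool" where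
  "ctrilinear \<psi> \<longleftrightarrow> (\<forall>z. cbilinear (\<lambda>x y. \<psi> x y z)) \<and>
     (\<forall>x y z z'. \<psi> x y (z + z') = \<psi> x y z + \<psi> x y z') \<and> (\<forall>x y c z. \<psi> x y (c *\<^sub>C z) = c *\<^sub>C \<psi> x y z)"

definition tensor3_ext ::
  "('a::complex_vector \<Rightarrow> 'b::complex_vector \<Rightarrow> 'c::complex_vector \<Rightarrow> complex) \<Rightarrow>
   (('a, 'b) tensor, 'c) tensor \<Rightarrow> complex" where
  "tensor3_ext \<psi> = tensor_ext (\<lambda>p z. tensor_ext (\<lambda>x y. \<psi> x y z) p)"

lemma cbilinear_tensor3_ext:
  assumes "ctrilinear \<psi>" shows "cbilinear (\<lambda>p z. tensor_ext (\<lambda>x y. \<psi> x y z) p)"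
  unfolding cbilinear_def
  using assms by (simp add: ctrilinear_def tensor_ext_add tensor_ext_scale tensor_ext_fun_add tensor_ext_fun_scale)

lemma tensor3_ext:
  assumes "ctrilinear \<psi>"
  shows "tensor3_ext \<psi> (s + t) = tensor3_ext \<psi> s + tensor3_ext \<psi> t"
    "tensor3_ext \<psi> (c *\<^sub>C t) = c *\<^sub>C tensor3_ext \<psi> t"
    "tensor3_ext \<psi> (x \<otimes> y \<otimes> z) = \<psi> x y z"
  using cbilinear_tensor3_ext[OF assms] assms
  by (simp_all add: tensor3_ext_def tensor_ext_add tensor_ext_scale tensor_ext_tensor ctrilinear_def)

lemma tensor3_ext_fun:
  "tensor3_ext (\<lambda>x y z. \<phi> x y z + \<psi> x y z) t = tensor3_ext \<phi> t + tensor3_ext \<psi> t"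
  "tensor3_ext (\<lambda>x y z. c *\<^sub>C \<phi> x y z) t = c *\<^sub>C tensor3_ext \<phi> t"
  by (simp_all add: tensor3_ext_def tensor_ext_fun_add tensor_ext_fun_scale)

text \<open>
  Extend \<open>h\<close> in its last three arguments first and then, after conjugation, in its first three.
\<close>

lemma sesquilinear_tensor3_exists:
  fixes h :: "'a::complex_vector \<Rightarrow> 'b::complex_vector \<Rightarrow> 'c::complex_vector \<Rightarrow> 'a \<Rightarrow> 'b \<Rightarrow> 'c \<Rightarrow> complex"
  assumes right: "\<And>x y z. ctrilinear (h x y z)"
    and left: "\<And>x' y' z'. ctrilinear (\<lambda>x y z. cnj (h x y z x' y' z'))"
  shows "\<exists>f. sesquilinear f \<and> (\<forall>x y z x' y' z'. f (x \<otimes> y \<otimes> z) (x' \<otimes> y' \<otimes> z') = h x y z x' y' z')"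
proof -
  define k where "k w = (\<lambda>x y z. cnj (tensor3_ext (h x y z) w))" for w
  have cnj2: "a = cnj b \<Longrightarrow> cnj a = b" for a b by simp
  have hl: "h (x1 + x2) y z = (\<lambda>x' y' z'. h x1 y z x' y' z' + h x2 y z x' y' z')"
     "h x (y1 + y2) z = (\<lambda>x' y' z'. h x y1 z x' y' z' + h x y2 z x' y' z')"
     "h x y (z1 + z2) = (\<lambda>x' y' z'. h x y z1 x' y' z' + h x y z2 x' y' z')"
     "h (c *\<^sub>C x) y z = (\<lambda>x' y' z'. cnj c *\<^sub>C h x y z x' y' z')"
     "h x (c *\<^sub>C y) z = (\<lambda>x' y' z'. cnj c *\<^sub>C h x y z x' y' z')"
     "h x y (c *\<^sub>C z) = (\<lambda>x' y' z'. cnj c *\<^sub>C h x y z x' y' z')"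
    for x y z x1 x2 y1 y2 z1 z2 c
    using left unfolding ctrilinear_def cbilinear_def scaleC_complex_def
    by (intro ext; metis complex_cnj_add complex_cnj_mult complex_cnj_cnj)+
  have k: "ctrilinear (k w)" for w
    unfolding ctrilinear_def cbilinear_def k_def hl tensor3_ext_fun
    by (simp add: scaleC_complex_def)
  have kw: "k (w + w') = (\<lambda>x y z. k w x y z + k w' x y z)" "k (c *\<^sub>C w) = (\<lambda>x y z. cnj c *\<^sub>C k w x y z)" for w w' c
    by (simp_all add: k_def tensor3_ext[OF right] scaleC_complex_def)
  define f where "f v w = cnj (tensor3_ext (k w) v)" for v w
  have "sesquilinear f"
    unfolding sesquilinear_def f_def kw tensor3_ext_fun
    by (simp add: tensor3_ext[OF k] scaleC_complex_def)
  moreover have "f (x \<otimes> y \<otimes> z) (x' \<otimes> y' \<otimes> z') = h x y z x' y' z'" for x y z x' y' z'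
    unfolding f_def tensor3_ext(3)[OF k] by (simp add: k_def tensor3_ext[OF right])
  ultimately show ?thesis by blast
qed

section \<open>Isometries with dense range\<close>

lemma seminorm_dist_eq:
  assumes "semi_inner V g"
  shows "seminorm_dist \<lparr>points = W, vadd = (+), vscale = scaleC, form = g\<rparr> v w = semi_inner.N g (v - w)"
  by (simp add: seminorm_dist_def semi_inner.N_def[OF assms] minus_as_scaleC Let_def)

text \<open>
  An isometry \<open>j\<close> from a finite-dimensional semi-inner product space into another semi-inner product
  space, with dense range, induces a unitary from the separation of the first to the completion of
  the second. Density means that every vector agrees with some \<open>j u\<close> up to a null vector. The
  classes of the completion are the sets \<open>K u\<close> of sequences that converge to \<open>j u\<close>, since the
  completeness of the finite-dimensional space gives every Cauchy sequence such a limit; the classes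
  of the separation are the sets \<open>D u\<close> of vectors at distance 0 from \<open>u\<close>. Both \<open>K u = K v\<close> and
  \<open>D u = D v\<close> mean that \<open>u - v\<close> is null, and the unitary sends \<open>D u\<close> to \<open>K u\<close>.
\<close>

lemma unitary_separation_completion:
  fixes g :: "'a::complex_vector \<Rightarrow> 'a \<Rightarrow> complex" and h :: "'c::complex_vector \<Rightarrow> 'c \<Rightarrow> complex"
  assumes fin: "cfinite_dim (UNIV :: 'a set)"
    and g: "semi_inner UNIV g" and h: "semi_inner V h"
    and j_add: "\<And>u v. j (u + v) = j u + j v" and j_scale: "\<And>c u. j (c *\<^sub>C u) = c *\<^sub>C j u"
    and j_in: "\<And>u. j u \<in> V" and isometry: "\<And>u v. h (j u) (j v) = g u v"
    and dense: "\<And>w. w \<in> V \<Longrightarrow> \<exists>u. h (w - j u) (w - j u) = 0"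
  defines "S \<equiv> \<lparr>points = UNIV, vadd = (+), vscale = scaleC, form = g\<rparr>"
    and "T \<equiv> \<lparr>points = V, vadd = (+), vscale = scaleC, form = h\<rparr>"
  shows "\<exists>\<Phi>. unitary_map (separation S) (sep_completion T) \<Phi> \<and>
    (\<forall>u. \<Phi> (sep_class S u) = sep_completion_class T (j u))"
proof -
  interpret g: semi_inner UNIV g by fact
  interpret h: semi_inner V h by fact
  have j_diff: "j (u - v) = j u - j v" for u v
    using j_add[of "u - v" v] by simp
  have N_j: "h.N (j u) = g.N u" for u by (simp add: h.N_def g.N_def isometry)
  have N_j_diff: "h.N (j u - j v) = g.N (u - v)" for u v by (simp only: N_j flip: j_diff)
  define lim_to where "lim_to X u \<longleftrightarrow> (\<forall>n. X n \<in> V) \<and> (\<lambda>n. h.N (X n - j u)) \<longlonglongrightarrow> 0" for X u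
  have lim_const: "lim_to (\<lambda>n. j u) u" for u by (simp add: lim_to_def j_in h.N_zero)
  have lim_add: "lim_to (\<lambda>n. X n + Y n) (u + v)" if X: "lim_to X u" and Y: "lim_to Y v" for X Y u v
  proof -
    have "(\<lambda>n. h.N (X n + Y n - j (u + v))) \<longlonglongrightarrow> 0"
    proof (rule real_tendsto_sandwich[OF always_eventually always_eventually tendsto_const])
      show "(\<lambda>n. h.N (X n - j u) + h.N (Y n - j v)) \<longlonglongrightarrow> 0"
        using X Y unfolding lim_to_def by (auto intro: tendsto_add_zero)
      show "\<forall>n. h.N (X n + Y n - j (u + v)) \<le> h.N (X n - j u) + h.N (Y n - j v)"
        using h.N_triangle[of "X n - j u" "Y n - j v" for n] X Y
        by (simp add: lim_to_def h.in_diff j_in j_add algebra_simps)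
      show "\<forall>n. 0 \<le> h.N (X n + Y n - j (u + v))"
        using X Y by (simp add: lim_to_def h.N_nonneg h.in_add h.in_diff j_in)
    qed
    then show ?thesis using X Y by (simp add: lim_to_def h.in_add)
  qed
  have lim_scale: "lim_to (\<lambda>n. c *\<^sub>C X n) (c *\<^sub>C u)" if X: "lim_to X u" for X u c
  proof -
    have "h.N (c *\<^sub>C X n - j (c *\<^sub>C u)) = cmod c * h.N (X n - j u)" for n
      using X h.N_scaleC[of "X n - j u" c]
      by (simp add: lim_to_def h.in_diff j_in j_scale complex_vector.scale_right_diff_distrib)
    then show ?thesis
      using X tendsto_mult_right_zero[of "\<lambda>n. h.N (X n - j u)" sequentially "cmod c"]
      by (simp add: lim_to_def h.in_scale)
  qed
  have lim_form: "(\<lambda>n. h (X n) (Y n)) \<longlonglongrightarrow> g u v" if X: "lim_to X u" and Y: "lim_to Y v" for X Y u v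
  proof -
    have XV: "X n \<in> V" and YV: "Y n \<in> V" for n using X Y by (auto simp: lim_to_def)
    let ?a = "\<lambda>n. h.N (X n - j u)" and ?b = "\<lambda>n. h.N (Y n - j v)"
    have "(\<lambda>n. h (X n) (Y n) - g u v) \<longlonglongrightarrow> 0"
    proof (rule Lim_null_comparison[OF always_eventually])
      show "\<forall>n. cmod (h (X n) (Y n) - g u v) \<le> ?a n * (?b n + h.N (j v)) + h.N (j u) * ?b n"
      proof
        fix n
        have "h (X n) (Y n) - g u v = h (X n - j u) (Y n) + h (j u) (Y n - j v)"
          by (simp add: h.g_simps isometry)
        then have "cmod (h (X n) (Y n) - g u v) \<le> cmod (h (X n - j u) (Y n)) + cmod (h (j u) (Y n - j v))"
          by (metis norm_triangle_ineq)
        also have "\<dots> \<le> ?a n * h.N (Y n) + h.N (j u) * ?b n"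
          by (intro add_mono h.cauchy_schwarz h.in_diff XV YV j_in)
        also have "h.N (Y n) \<le> ?b n + h.N (j v)"
          using h.N_triangle[of "Y n - j v" "j v"] by (simp add: h.in_diff YV j_in)
        finally show "cmod (h (X n) (Y n) - g u v) \<le> ?a n * (?b n + h.N (j v)) + h.N (j u) * ?b n"
          by (simp add: mult_left_mono h.N_nonneg h.in_diff XV j_in)
      qed
      have "(\<lambda>n. ?a n * (?b n + h.N (j v)) + h.N (j u) * ?b n) \<longlonglongrightarrow> 0 * (0 + h.N (j v)) + h.N (j u) * 0"
        using X Y unfolding lim_to_def by (intro tendsto_intros) auto
      then show "(\<lambda>n. ?a n * (?b n + h.N (j v)) + h.N (j u) * ?b n) \<longlonglongrightarrow> 0" by simp
    qed
    then show ?thesis by (rule LIM_zero_cancel)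
  qed
  let ?C = "cauchy_space T"
  have dist_T: "seminorm_dist T x y = h.N (x - y)" for x y
    unfolding T_def by (rule seminorm_dist_eq[OF h])
  have C_sel: "vadd ?C X Y = (\<lambda>n. X n + Y n)" "vscale ?C c X = (\<lambda>n. c *\<^sub>C X n)"
    "form ?C X Y = lim (\<lambda>n. h (X n) (Y n))" for X Y c
    by (simp_all add: cauchy_space_def T_def)
  have form_C: "form ?C X Y = g u v" if "lim_to X u" "lim_to Y v" for X Y u v
    unfolding C_sel using lim_form[OF that] by (rule limI)
  have dist_C: "seminorm_dist ?C X Y = g.N (u - v)" if "lim_to X u" "lim_to Y v" for X Y u v
  proof -
    have "lim_to (\<lambda>n. X n + (- 1) *\<^sub>C Y n) (u + (- 1) *\<^sub>C v)"
      by (intro lim_add lim_scale that)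
    from form_C[OF this this] show ?thesis unfolding seminorm_dist_def Let_def
      by (simp add: C_sel g.N_def minus_as_scaleC)
  qed
  have points_C: "X \<in> points ?C \<longleftrightarrow> (\<exists>u. lim_to X u)" for X
  proof
    assume "X \<in> points ?C"
    then have XV: "X n \<in> V" and cau: "\<epsilon> > 0 \<Longrightarrow> \<exists>M. \<forall>m\<ge>M. \<forall>n\<ge>M. h.N (X m - X n) < \<epsilon>" for n \<epsilon>
      by (auto simp: cauchy_space_def T_def dist_T[unfolded T_def])
    obtain U where "\<And>n. h (X n - j (U n)) (X n - j (U n)) = 0" using dense[OF XV] by metis
    then have U: "h.N (X n - j (U n)) = 0" for n by (simp add: h.N_def)
    have close: "h.N (X m - X n) = g.N (U m - U n)" for m n
    proof -
      have a: "h.N (X m - X n) \<le> h.N (X m - j (U m)) + (h.N (j (U m) - j (U n)) + h.N (j (U n) - X n))"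
        by (intro order.trans[OF h.N_triangle_diff add_left_mono[OF h.N_triangle_diff]] XV j_in)
      have b: "h.N (j (U m) - j (U n)) \<le> h.N (j (U m) - X m) + (h.N (X m - X n) + h.N (X n - j (U n)))"
        by (intro order.trans[OF h.N_triangle_diff add_left_mono[OF h.N_triangle_diff]] XV j_in)
      show ?thesis
        using a b U h.N_minus_commute[OF XV j_in] by (simp add: N_j_diff)
    qed
    obtain F :: "'a set" where F: "finite F" "UNIV = cspan F" using fin by (auto simp: cfinite_dim_def)
    obtain u where u: "(\<lambda>n. g.N (U n - u)) \<longlonglongrightarrow> 0"
      using g.complete[OF F, of U] cau by (auto simp: close)
    have "(\<lambda>n. h.N (X n - j u)) \<longlonglongrightarrow> 0"
    proof (rule real_tendsto_sandwich[OF always_eventually always_eventually tendsto_const u])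
      show "\<forall>n. 0 \<le> h.N (X n - j u)" by (simp add: h.N_nonneg h.in_diff XV j_in)
      have "h.N (X n - j u) \<le> g.N (U n - u)" for n
        using h.N_triangle_diff[OF XV j_in j_in, of n u "U n"] by (simp only: N_j_diff U add_0)
      then show "\<forall>n. h.N (X n - j u) \<le> g.N (U n - u)" ..
    qed
    then show "\<exists>u. lim_to X u" using XV by (auto simp: lim_to_def)
  next
    assume "\<exists>u. lim_to X u"
    then obtain u where X: "\<And>n. X n \<in> V" "(\<lambda>n. h.N (X n - j u)) \<longlonglongrightarrow> 0" by (auto simp: lim_to_def)
    have "\<exists>M. \<forall>m\<ge>M. \<forall>n\<ge>M. h.N (X m - X n) < \<epsilon>" if "\<epsilon> > 0" for \<epsilon> :: real
    proof -
      have "\<forall>\<^sub>F n in sequentially. h.N (X n - j u) < \<epsilon> / 2"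
        using X(2) by (rule order_tendstoD) (simp add: that)
      then obtain M where M: "\<And>n. n \<ge> M \<Longrightarrow> h.N (X n - j u) < \<epsilon> / 2"
        by (auto simp: eventually_sequentially)
      have "h.N (X m - X n) < \<epsilon>" if "m \<ge> M" "n \<ge> M" for m n
        using h.N_triangle_diff[OF X(1) j_in X(1), of m n u] h.N_minus_commute[OF X(1) j_in, of n u]
          M[OF that(1)] M[OF that(2)] by simp
      then show ?thesis by blast
    qed
    then show "X \<in> points ?C" using X(1) by (simp add: cauchy_space_def T_def dist_T[unfolded T_def])
  qed
  define K where "K u = {X. lim_to X u}" for u
  define D where "D u = {w. g.N (u - w) = 0}" for u
  have lim_shift: "lim_to X v" if X: "lim_to X u" and uv: "g.N (u - v) = 0" for X u v
  proof -
    have XV: "X n \<in> V" for n using X by (simp add: lim_to_def)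
    have "(\<lambda>n. h.N (X n - j v)) \<longlonglongrightarrow> 0"
    proof (rule real_tendsto_sandwich[OF always_eventually always_eventually tendsto_const])
      show "(\<lambda>n. h.N (X n - j u)) \<longlonglongrightarrow> 0" using X by (simp add: lim_to_def)
      have "h.N (X n - j v) \<le> h.N (X n - j u)" for n
        using h.N_triangle_diff[OF XV j_in j_in, of n v u] by (simp only: N_j_diff uv add_0_right)
      then show "\<forall>n. h.N (X n - j v) \<le> h.N (X n - j u)" ..
    qed (simp add: h.N_nonneg h.in_diff XV j_in)
    then show ?thesis using XV by (simp add: lim_to_def)
  qed
  have sep_C: "sep_class ?C X = K u" if "lim_to X u" for X u
    using dist_C[OF that] lim_shift points_C g.N_minus_commute[of u] unfolding sep_class_def K_def
    by (auto simp: g.g_simps) (metis diff_self g.N_zero)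
  have sep_S: "sep_class S u = D u" for u
    by (simp add: sep_class_def D_def S_def seminorm_dist_eq[OF g])
  have D_eq: "D u = D v \<longleftrightarrow> g.N (u - v) = 0" for u v
  proof
    assume "D u = D v"
    moreover have "v \<in> D v" by (simp add: D_def g.N_zero)
    ultimately have "v \<in> D u" by simp
    then show "g.N (u - v) = 0" by (simp add: D_def)
  next
    assume uv: "g.N (u - v) = 0"
    have le: "g.N (a - c) = 0" if "g.N (a - b) = 0" "g.N (b - c) = 0" for a b c
      using g.N_triangle_diff[of a b c] g.N_nonneg[of "a - c"] that by simp
    show "D u = D v"
      using le uv g.N_minus_commute[of u v] unfolding D_def by (metis (lifting) UNIV_I)
  qed
  have K_eq: "K u = K v \<longleftrightarrow> g.N (u - v) = 0" for u v
  proof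
    assume "K u = K v"
    then have "lim_to (\<lambda>n. j u) v" using lim_const[of u] by (auto simp: K_def)
    then show "g.N (u - v) = 0"
      using dist_C[OF lim_const[of u] lim_const[of u]] dist_C[OF lim_const[of u], of "\<lambda>n. j u" v]
      by (simp add: g.N_zero)
  next
    assume uv: "g.N (u - v) = 0"
    then show "K u = K v"
      using lim_shift g.N_minus_commute[of u v] unfolding K_def by (auto intro: lim_shift)
  qed
  have rep_K: "lim_to (rep (K u)) u" for u
    using someI[of "\<lambda>X. X \<in> K u", OF CollectI[of "\<lambda>X. lim_to X u", OF lim_const, folded K_def]]
    by (simp add: rep_def K_def)
  have rep_D: "g.N (u - rep (D u)) = 0" for u
  proof -
    have "u \<in> D u" by (simp add: D_def g.N_zero)
    then have "rep (D u) \<in> D u" unfolding rep_def by (rule someI)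
    then show ?thesis by (simp add: D_def)
  qed
  define \<Phi> where "\<Phi> X = K (rep X)" for X
  have \<Phi>_D: "\<Phi> (D u) = K u" for u
    using rep_D[of u] g.N_minus_commute[of u "rep (D u)"] by (simp add: \<Phi>_def K_eq)
  have points_S: "points (separation S) = range D"
    by (simp add: separation_def sep_S) (simp add: S_def)
  have points_T: "points (sep_completion T) = range K"
  proof -
    have "sep_class ?C X \<in> range K" if "X \<in> points ?C" for X
      using that sep_C points_C by blast
    moreover have "K u \<in> sep_class ?C ` points ?C" for u
      using sep_C[OF lim_const[of u]] lim_const[of u] points_C by (metis imageI)
    ultimately show ?thesis by (auto simp: sep_completion_def separation_def)
  qed
  have add_S: "vadd (separation S) (D u) (D v) = D (u + v)" for u v
  proof -
    have "g.N ((rep (D u) + rep (D v)) - (u + v)) = 0"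
      using g.N_triangle[of "rep (D u) - u" "rep (D v) - v"] rep_D[of u] rep_D[of v]
        g.N_minus_commute[of u "rep (D u)"] g.N_minus_commute[of v "rep (D v)"]
        g.N_nonneg[of "(rep (D u) + rep (D v)) - (u + v)"]
      by (simp add: algebra_simps)
    then show ?thesis by (simp add: separation_def sep_S D_eq) (simp add: S_def D_eq)
  qed
  have scale_S: "vscale (separation S) c (D u) = D (c *\<^sub>C u)" for c u
  proof -
    have "g.N (c *\<^sub>C rep (D u) - c *\<^sub>C u) = 0"
      using g.N_scaleC[of "rep (D u) - u" c] rep_D[of u] g.N_minus_commute[of u "rep (D u)"]
      by (simp add: complex_vector.scale_right_diff_distrib)
    then show ?thesis by (simp add: separation_def sep_S) (simp add: S_def D_eq)
  qed
  have form_S: "form (separation S) (D u) (D v) = g u v" for u v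
  proof -
    have "g u v - g (rep (D u)) (rep (D v)) = g (u - rep (D u)) v + g (rep (D u)) (v - rep (D v))"
      by (simp add: g.g_simps)
    also have "\<dots> = 0" using rep_D g.null_form by simp
    finally show ?thesis by (simp add: separation_def) (simp add: S_def)
  qed
  have add_T: "vadd (sep_completion T) (K u) (K v) = K (u + v)" for u v
    using sep_C[OF lim_add[OF rep_K rep_K]] by (simp add: sep_completion_def separation_def C_sel)
  have scale_T: "vscale (sep_completion T) c (K u) = K (c *\<^sub>C u)" for c u
    using sep_C[OF lim_scale[OF rep_K]] by (simp add: sep_completion_def separation_def C_sel)
  have form_T: "form (sep_completion T) (K u) (K v) = g u v" for u v
    using form_C[OF rep_K rep_K] by (simp add: sep_completion_def separation_def)
  have "bij_betw \<Phi> (range D) (range K)"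
    unfolding bij_betw_def inj_on_def image_image \<Phi>_D by (auto simp: \<Phi>_D K_eq D_eq)
  then have "unitary_map (separation S) (sep_completion T) \<Phi>"
    unfolding unitary_map_def points_S points_T
    by (auto simp: \<Phi>_D add_S add_T scale_S scale_T form_S form_T)
  moreover have "\<Phi> (sep_class S u) = sep_completion_class T (j u)" for u
    by (simp add: sep_completion_class_def sep_C[OF lim_const] sep_S \<Phi>_D)
  ultimately show ?thesis by blast
qed

section \<open>Factorizations over a base with a bicyclic vector\<close>

lemma csubspace_orbit:
  assumes A: "csubspace A" shows "csubspace {a \<cdot> x | a. a \<in> A}"
proof (rule complex_vector.subspaceI)
  show "0 \<in> {a \<cdot> x | a. a \<in> A}"
    using complex_vector.subspace_0[OF A] by (force simp: cblin_zero_left)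
  show "y + z \<in> {a \<cdot> x | a. a \<in> A}" if "y \<in> {a \<cdot> x | a. a \<in> A}" "z \<in> {a \<cdot> x | a. a \<in> A}" for y z
    using that complex_vector.subspace_add[OF A] by (force simp flip: cblin_add_left)
  show "c *\<^sub>C y \<in> {a \<cdot> x | a. a \<in> A}" if "y \<in> {a \<cdot> x | a. a \<in> A}" for c y
    using that complex_vector.subspace_scale[OF A] by (force simp flip: cblin_scaleC_left)
qed

text \<open>
  A factorization \<open>\<alpha>\<close> over a finite-dimensional base \<open>(B, B')\<close> with bicyclic vector \<open>\<zeta>\<close>. In finite
  dimensions no closures are needed: every vector of the base is of the form \<open>b \<zeta>\<close>.
\<close>

locale cyclic_factorization =
  fixes B B' :: "('b::chilbert_space, 'b) cblin set" and \<zeta> :: 'b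
    and \<alpha> :: "('b, 'h::chilbert_space) cblin set"
  assumes fin_base: "cfinite_dim (UNIV :: 'b set)"
    and commute: "b \<in> B \<Longrightarrow> b' \<in> B' \<Longrightarrow> b \<cdot> b' \<cdot> x = b' \<cdot> b \<cdot> x"
    and cyclic: "\<exists>b\<in>B. b \<cdot> \<zeta> = x" and cyclic': "\<exists>b'\<in>B'. b' \<cdot> \<zeta> = x"
    and subspace: "csubspace \<alpha>"
    and inner_in: "\<xi> \<in> \<alpha> \<Longrightarrow> \<xi>' \<in> \<alpha> \<Longrightarrow> adj \<xi> o\<^sub>C \<xi>' \<in> B"
    and compose_in: "\<xi> \<in> \<alpha> \<Longrightarrow> b \<in> B \<Longrightarrow> \<xi> o\<^sub>C b \<in> \<alpha>"
    and ranges: "cspan {\<xi> \<cdot> \<omega> | \<xi> \<omega>. \<xi> \<in> \<alpha>} = UNIV"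
begin

text \<open>
  An element of \<open>\<alpha>\<close> is determined by its value at \<open>\<zeta>\<close>: all \<open>\<xi>\<^sup>* a\<close> lie in \<open>B\<close> and hence commute with
  \<open>B'\<close>, so that \<open>a \<zeta> = 0\<close> gives \<open>\<xi>\<^sup>* a b' \<zeta> = b' \<xi>\<^sup>* a \<zeta> = 0\<close>.
\<close>

lemma separating:
  assumes a: "a \<in> \<alpha>" "a \<cdot> \<zeta> = 0" shows "a = 0"
proof (rule cblin_eqI)
  fix x
  obtain b' where b': "b' \<in> B'" "b' \<cdot> \<zeta> = x" using cyclic' by blast
  have "cinner (\<xi> \<cdot> \<omega>) (a \<cdot> x) = 0" if "\<xi> \<in> \<alpha>" for \<xi> \<omega>
  proof -
    have "cinner (\<xi> \<cdot> \<omega>) (a \<cdot> x) = cinner \<omega> ((adj \<xi> o\<^sub>C a) \<cdot> b' \<cdot> \<zeta>)"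
      by (simp add: cinner_adj_right fin_base b')
    also have "\<dots> = cinner \<omega> (b' \<cdot> (adj \<xi> o\<^sub>C a) \<cdot> \<zeta>)"
      using commute[OF inner_in[OF that a(1)] b'(1)] by simp
    also have "\<dots> = 0" by (simp add: a cblin_zero cinner_simps)
    finally show ?thesis .
  qed
  then have "cspan {\<xi> \<cdot> \<omega> | \<xi> \<omega>. \<xi> \<in> \<alpha>} \<subseteq> {z. cinner z (a \<cdot> x) = 0}"
    by (intro complex_vector.span_minimal) (auto simp: complex_vector.subspace_def cinner_simps)
  then have "a \<cdot> x = 0" using ranges cinner_eq_zero_iff by blast
  then show "a \<cdot> x = 0 \<cdot> x" by (simp add: cblin_zero_left)
qed

text \<open>Conversely, \<open>\<xi> b \<zeta>\<close> is the value at \<open>\<zeta>\<close> of \<open>\<xi> b\<close>, an element of \<open>\<alpha>\<close>.\<close>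

lemma vector_exists: "\<exists>a\<in>\<alpha>. a \<cdot> \<zeta> = x"
proof -
  let ?W = "{a \<cdot> \<zeta> | a. a \<in> \<alpha>}"
  have "csubspace ?W" by (rule csubspace_orbit[OF subspace])
  moreover have "\<xi> \<cdot> \<omega> \<in> ?W" if "\<xi> \<in> \<alpha>" for \<xi> \<omega>
  proof -
    obtain b where "b \<in> B" "b \<cdot> \<zeta> = \<omega>" using cyclic by blast
    then show ?thesis using compose_in[OF that, of b] by force
  qed
  ultimately have "cspan {\<xi> \<cdot> \<omega> | \<xi> \<omega>. \<xi> \<in> \<alpha>} \<subseteq> ?W"
    by (intro complex_vector.span_minimal) auto
  then have "x \<in> ?W" unfolding ranges by (rule subsetD) simp
  then obtain a where "a \<in> \<alpha>" "x = a \<cdot> \<zeta>" by blast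
  then show ?thesis by (intro bexI[of _ a]) simp_all
qed

text \<open>The inverse of the linear bijection \<open>a \<mapsto> a \<zeta>\<close> from \<open>\<alpha>\<close> onto the factorized space.\<close>

definition lift_vector :: "'h \<Rightarrow> ('b, 'h) cblin" where
  "lift_vector x = (SOME a. a \<in> \<alpha> \<and> a \<cdot> \<zeta> = x)"

lemma lift_in: "lift_vector x \<in> \<alpha>" and lift_apply: "lift_vector x \<cdot> \<zeta> = x"
proof -
  have "\<exists>a. a \<in> \<alpha> \<and> a \<cdot> \<zeta> = x" using vector_exists by blast
  from someI_ex[OF this] show "lift_vector x \<in> \<alpha>" "lift_vector x \<cdot> \<zeta> = x"
    by (auto simp: lift_vector_def)
qed

lemma lift_vectorI: "a \<in> \<alpha> \<Longrightarrow> a \<cdot> \<zeta> = x \<Longrightarrow> lift_vector x = a"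
proof -
  assume a: "a \<in> \<alpha>" "a \<cdot> \<zeta> = x"
  have "lift_vector x - a = 0"
    by (rule separating)
      (simp_all add: complex_vector.subspace_diff[OF subspace] lift_in a cblin_diff_left lift_apply)
  then show ?thesis by simp
qed

lemma lift_add: "lift_vector (x + y) = lift_vector x + lift_vector y"
  by (rule lift_vectorI)
    (simp_all add: complex_vector.subspace_add[OF subspace] lift_in lift_apply cblin_add_left)

lemma lift_scaleC: "lift_vector (c *\<^sub>C x) = c *\<^sub>C lift_vector x"
  by (rule lift_vectorI)
    (simp_all add: complex_vector.subspace_scale[OF subspace] lift_in lift_apply cblin_scaleC_left)

lemma lift_compose: "b \<in> B \<Longrightarrow> \<xi> \<in> \<alpha> \<Longrightarrow> lift_vector (\<xi> \<cdot> b \<cdot> \<zeta>) = \<xi> o\<^sub>C b"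
  by (rule lift_vectorI) (simp_all add: compose_in)

text \<open>
  As \<open>factorization_rep\<close> is a definite description, an operator with its defining property has to
  be exhibited. It sends \<open>a \<zeta>\<close> to \<open>a b' \<zeta>\<close> for \<open>a \<in> \<alpha>\<close>.
\<close>

lemma factorization_rep_apply:
  assumes fin: "cfinite_dim (UNIV :: 'h set)" and b': "b' \<in> B'" and \<xi>: "\<xi> \<in> \<alpha>"
  shows "factorization_rep \<alpha> b' \<cdot> \<xi> \<cdot> \<omega> = \<xi> \<cdot> b' \<cdot> \<omega>"
proof -
  have "\<exists>T. \<forall>x. T \<cdot> x = lift_vector x \<cdot> b' \<cdot> \<zeta>"
    by (rule finite_dim_cblin_exists[OF fin])
      (simp_all add: lift_add lift_scaleC cblin_add_left cblin_scaleC_left)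
  then obtain T where T: "\<And>x. T \<cdot> x = lift_vector x \<cdot> b' \<cdot> \<zeta>" by blast
  have T\<xi>: "T \<cdot> \<xi> \<cdot> \<omega> = \<xi> \<cdot> b' \<cdot> \<omega>" if \<xi>: "\<xi> \<in> \<alpha>" for \<xi> \<omega>
  proof -
    obtain b where b: "b \<in> B" "b \<cdot> \<zeta> = \<omega>" using cyclic by blast
    then have "T \<cdot> \<xi> \<cdot> \<omega> = \<xi> \<cdot> b \<cdot> b' \<cdot> \<zeta>"
      by (simp add: T lift_compose \<xi> flip: b(2))
    then show ?thesis by (simp add: commute[OF b(1) b'] b(2))
  qed
  have "factorization_rep \<alpha> b' = T"
    unfolding factorization_rep_def
  proof (rule the_equality)
    fix S assume S: "\<forall>\<xi>\<in>\<alpha>. \<forall>\<omega>. S \<cdot> \<xi> \<cdot> \<omega> = \<xi> \<cdot> b' \<cdot> \<omega>"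
    have "cspan {\<xi> \<cdot> \<omega> | \<xi> \<omega>. \<xi> \<in> \<alpha>} \<subseteq> {x. S \<cdot> x = T \<cdot> x}"
      using S T\<xi> by (intro complex_vector.span_minimal)
        (auto simp: complex_vector.subspace_def cblin_zero cblin_add cblin_scaleC)
    then show "S = T" unfolding ranges by (intro cblin_eqI) blast
  qed (use T\<xi> in blast)
  then show ?thesis using T\<xi> \<xi> by simp
qed

text \<open>
  The vector \<open>x = a \<zeta>\<close> has \<open>R(x) U = a\<close>, because both sides send \<open>b' \<zeta>\<close> to \<open>a b' \<zeta>\<close>. Of the
  representation \<open>P\<close> nothing is needed except its range. The lemma applies to the opposite GNS
  representation and, with the roles of \<open>B\<close> and \<open>B'\<close> interchanged, to the GNS representation.
\<close>

lemma R_op_eq: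
  fixes P :: "'n \<Rightarrow> ('m::chilbert_space, 'm) cblin" and U :: "('b, 'm) cblin"
  assumes fin: "cfinite_dim (UNIV :: 'h set)"
    and U: "unitary_op U" "Ad U ` B' = range P" "U \<cdot> \<zeta> = \<zeta>\<^sub>\<mu>"
    and \<rho>: "\<rho> = factorization_rep \<alpha> \<circ> Ad (adj U) \<circ> P"
  shows "R_op P \<zeta>\<^sub>\<mu> \<rho> x = lift_vector x o\<^sub>C adj U"
proof -
  have UU: "adj U \<cdot> U \<cdot> y = y" "U \<cdot> adj U \<cdot> z = z" for y z
    using U(1) by (metis cblin_compose_apply id_cblin_apply unitary_op_def)+
  have on_cyclic: "P n \<cdot> \<zeta>\<^sub>\<mu> = U \<cdot> b' \<cdot> \<zeta>" "\<rho> n \<cdot> x = lift_vector x \<cdot> b' \<cdot> \<zeta>"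
    if b': "b' \<in> B'" and n: "P n = Ad U b'" for n b'
  proof -
    show "P n \<cdot> \<zeta>\<^sub>\<mu> = U \<cdot> b' \<cdot> \<zeta>" by (simp add: n Ad_def UU flip: U(3))
    have "Ad (adj U) (P n) = b'"
      by (rule cblin_eqI) (simp add: n Ad_def UU adj_adj fin_base)
    then have "\<rho> n \<cdot> lift_vector x \<cdot> \<zeta> = lift_vector x \<cdot> b' \<cdot> \<zeta>"
      by (simp add: \<rho> factorization_rep_apply fin b' lift_in)
    then show "\<rho> n \<cdot> x = lift_vector x \<cdot> b' \<cdot> \<zeta>" by (simp add: lift_apply)
  qed
  show ?thesis
    unfolding R_op_def
  proof (rule the_equality, intro allI)
    fix n
    obtain b' where b': "b' \<in> B'" "P n = Ad U b'" using U(2) by blast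
    show "(lift_vector x o\<^sub>C adj U) \<cdot> P n \<cdot> \<zeta>\<^sub>\<mu> = \<rho> n \<cdot> x"
      by (simp add: on_cyclic[OF b'] UU)
  next
    fix T assume T: "\<forall>n. T \<cdot> P n \<cdot> \<zeta>\<^sub>\<mu> = \<rho> n \<cdot> x"
    show "T = lift_vector x o\<^sub>C adj U"
    proof (rule cblin_eqI)
      fix y
      obtain b' where b': "b' \<in> B'" "b' \<cdot> \<zeta> = adj U \<cdot> y" using cyclic' by blast
      obtain n where n: "P n = Ad U b'" using U(2) b'(1) by (metis imageE image_eqI rangeI)
      from T have "T \<cdot> P n \<cdot> \<zeta>\<^sub>\<mu> = \<rho> n \<cdot> x" ..
      then show "T \<cdot> y = (lift_vector x o\<^sub>C adj U) \<cdot> y"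
        by (simp add: on_cyclic[OF b'(1) n] b'(2) UU)
    qed
  qed
qed

end

lemma cyclic_factorizationI:
  fixes B B' :: "('b::chilbert_space, 'b) cblin set" and \<alpha> :: "('b, 'h::chilbert_space) cblin set"
  assumes fin: "cfinite_dim (UNIV :: 'b set)" "cfinite_dim (UNIV :: 'h set)"
    and base: "cstar_base B B'" and bicyclic: "bicyclic_vector B B' \<zeta>"
    and fac: "cstar_factorization B \<alpha>"
  shows "cyclic_factorization B B' \<zeta> \<alpha>"
proof
  have reach: "\<exists>b\<in>A. b \<cdot> \<zeta> = x" if "csubspace A" "cyclic_vector A \<zeta>" for A x
  proof -
    have "cspan {b \<cdot> \<zeta> | b. b \<in> A} = {b \<cdot> \<zeta> | b. b \<in> A}"
      using csubspace_orbit[OF that(1)] by (simp only: complex_vector.span_eq_iff)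
    moreover have "cspan {b \<cdot> \<zeta> | b. b \<in> A} = UNIV"
      using that(2) unfolding cyclic_vector_def by (rule cspan_eq_UNIV[OF fin(1)])
    ultimately have "x \<in> {b \<cdot> \<zeta> | b. b \<in> A}" by (metis UNIV_I)
    then obtain b where "b \<in> A" "x = b \<cdot> \<zeta>" by blast
    then show ?thesis by (intro bexI[of _ b]) simp_all
  qed
  have closed_cspanI: "y \<in> closed_cspan Y" if "y \<in> Y" for y :: "'c::complex_normed_vector" and Y
    using that unfolding closed_cspan_def
    by (meson closure_subset complex_vector.span_base subsetD)
  show "cfinite_dim (UNIV :: 'b set)" by fact
  show "b \<cdot> b' \<cdot> x = b' \<cdot> b \<cdot> x" if "b \<in> B" "b' \<in> B'" for b b' x
    using base that by (metis cblin_compose_apply cstar_base_def)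
  show "\<exists>b\<in>B. b \<cdot> \<zeta> = x" "\<exists>b'\<in>B'. b' \<cdot> \<zeta> = x" for x
    using reach base bicyclic by (auto simp: cstar_base_def cstar_subalgebra_def bicyclic_vector_def)
  show "csubspace \<alpha>" using fac by (simp add: cstar_factorization_def)
  show "adj \<xi> o\<^sub>C \<xi>' \<in> B" if "\<xi> \<in> \<alpha>" "\<xi>' \<in> \<alpha>" for \<xi> \<xi>'
  proof -
    have "adj \<xi> o\<^sub>C \<xi>' \<in> closed_cspan {adj \<xi> o\<^sub>C \<xi>' | \<xi> \<xi>'. \<xi> \<in> \<alpha> \<and> \<xi>' \<in> \<alpha>}"
      using that by (intro closed_cspanI) blast
    then show ?thesis using fac by (simp add: cstar_factorization_def)
  qed
  show "\<xi> o\<^sub>C b \<in> \<alpha>" if "\<xi> \<in> \<alpha>" "b \<in> B" for \<xi> b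
  proof -
    have "\<xi> o\<^sub>C b \<in> closed_cspan {\<xi> o\<^sub>C b | \<xi> b. \<xi> \<in> \<alpha> \<and> b \<in> B}"
      using that by (intro closed_cspanI) blast
    then show ?thesis using fac by (simp add: cstar_factorization_def)
  qed
  show "cspan {\<xi> \<cdot> \<omega> | \<xi> \<omega>. \<xi> \<in> \<alpha>} = UNIV"
    using cspan_eq_UNIV[OF fin(2)] fac by (simp add: cstar_factorization_def)
qed

section \<open>The two relative tensor products\<close>

text \<open>The sesquilinear form on threefold tensors that \<open>cstar_rel_form\<close> describes exists and is unique.\<close>

lemma cstar_rel_form:
  assumes fin: "cfinite_dim (UNIV :: 'b::chilbert_space set)"
  shows "sesquilinear (cstar_rel_form ::
      ('b, 'h::chilbert_space, 'k::chilbert_space) tensor3 \<Rightarrow> ('b, 'h, 'k) tensor3 \<Rightarrow> complex)"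
    and "cstar_rel_form (\<xi> \<otimes> \<omega> \<otimes> \<eta>) (\<xi>' \<otimes> \<omega>' \<otimes> \<eta>' :: ('b, 'h, 'k) tensor3) =
      cinner \<omega> (adj \<xi> \<cdot> \<xi>' \<cdot> adj \<eta> \<cdot> \<eta>' \<cdot> \<omega>')"
proof -
  let ?P = "\<lambda>f :: ('b, 'h, 'k) tensor3 \<Rightarrow> ('b, 'h, 'k) tensor3 \<Rightarrow> complex. sesquilinear f \<and>
     (\<forall>\<xi> \<omega> \<eta> \<xi>' \<omega>' \<eta>'. f (\<xi> \<otimes> \<omega> \<otimes> \<eta>) (\<xi>' \<otimes> \<omega>' \<otimes> \<eta>') =
        cinner \<omega> ((adj \<xi> o\<^sub>C \<xi>') \<cdot> (adj \<eta> o\<^sub>C \<eta>') \<cdot> \<omega>'))"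
  have ex: "\<exists>f. ?P f"
    by (rule sesquilinear_tensor3_exists)
      (simp_all add: ctrilinear_def cbilinear_def cblin_add_left cblin_scaleC_left cblin_add cblin_scaleC
        adj_add adj_scaleC fin cinner_simps scaleC_complex_def)
  have unique: "f = f'" if "?P f" "?P f'" for f f'
    using that by (intro sesquilinear_unique[OF _ _ cspan_tensor3]) auto
  have "\<exists>!f. ?P f" by (rule ex_ex1I[OF ex unique])
  then have "?P cstar_rel_form" unfolding cstar_rel_form_def by (rule theI')
  then show "sesquilinear (cstar_rel_form ::
      ('b, 'h, 'k) tensor3 \<Rightarrow> ('b, 'h, 'k) tensor3 \<Rightarrow> complex)"
    and "cstar_rel_form (\<xi> \<otimes> \<omega> \<otimes> \<eta>) (\<xi>' \<otimes> \<omega>' \<otimes> \<eta>' :: ('b, 'h, 'k) tensor3) =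
      cinner \<omega> (adj \<xi> \<cdot> \<xi>' \<cdot> adj \<eta> \<cdot> \<eta>' \<cdot> \<omega>')"
    by auto
qed

text \<open>Factorizations with respect to a base and to the opposite base, with a common bicyclic vector.\<close>

locale factorization_pair =
  A: cyclic_factorization B B' \<zeta> \<alpha> + C: cyclic_factorization B' B \<zeta> \<beta>
  for B B' :: "('b::chilbert_space, 'b) cblin set" and \<zeta> :: 'b
    and \<alpha> :: "('b, 'h::chilbert_space) cblin set" and \<beta> :: "('b, 'k::chilbert_space) cblin set"
begin

lemma commute:
  assumes "\<xi> \<in> \<alpha>" "\<xi>' \<in> \<alpha>" "\<eta> \<in> \<beta>" "\<eta>' \<in> \<beta>"
  shows "adj \<xi> \<cdot> \<xi>' \<cdot> adj \<eta> \<cdot> \<eta>' \<cdot> x = adj \<eta> \<cdot> \<eta>' \<cdot> adj \<xi> \<cdot> \<xi>' \<cdot> x"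
  using A.commute[OF A.inner_in[OF assms(1,2)] C.inner_in[OF assms(3,4)]] by simp

text \<open>The elementary tensors whose outer factors belong to the two factorizations.\<close>

abbreviation generators :: "('b, 'h, 'k) tensor3 set" where
  "generators \<equiv> {\<xi> \<otimes> \<omega> \<otimes> \<eta> | \<xi> \<omega> \<eta>. \<xi> \<in> \<alpha> \<and> \<eta> \<in> \<beta>}"

lemmas form_simps = sesquilinear_simps[OF cstar_rel_form(1)[OF A.fin_base]]

lemma generators_sum:
  assumes "v \<in> cspan generators"
  shows "\<exists>n \<xi> \<omega> \<eta>. (\<forall>i. \<xi> i \<in> \<alpha> \<and> \<eta> i \<in> \<beta>) \<and> v = (\<Sum>i<n::nat. \<xi> i \<otimes> \<omega> i \<otimes> \<eta> i)"
  using assms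
proof (induction rule: complex_vector.span_induct_alt)
  case base
  have "0 \<in> \<alpha>" "0 \<in> \<beta>"
    using A.subspace C.subspace by (auto intro: complex_vector.subspace_0)
  then show ?case
    by (intro exI[of _ 0] exI[of _ "\<lambda>_. 0"]) simp
next
  case (step c x y)
  then obtain n \<xi> \<omega> \<eta> where y: "\<forall>i. \<xi> i \<in> \<alpha> \<and> \<eta> i \<in> \<beta>" "y = (\<Sum>i<n::nat. \<xi> i \<otimes> \<omega> i \<otimes> \<eta> i)"
    by auto
  obtain \<xi>' \<omega>' \<eta>' where x: "x = \<xi>' \<otimes> \<omega>' \<otimes> \<eta>'" "\<xi>' \<in> \<alpha>" "\<eta>' \<in> \<beta>" using step by blast
  show ?case
    using y x
    by (intro exI[of _ "Suc n"] exI[of _ "fun_upd \<xi> n \<xi>'"]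
        exI[of _ "fun_upd \<omega> n (c *\<^sub>C \<omega>')"] exI[of _ "fun_upd \<eta> n \<eta>'"])
      (simp add: tensor_scale_left tensor_scale_right add.commute)
qed

text \<open>
  Hermitian symmetry comes from the commutation of \<open>B\<close> with \<open>B'\<close>, and positivity from
  \<open>schur_product_positive\<close>.
\<close>

lemma semi_inner_form: "semi_inner (cspan generators) cstar_rel_form"
proof
  show "csubspace (cspan generators)" by (rule complex_vector.subspace_span)
  show "sesquilinear (cstar_rel_form :: ('b, 'h, 'k) tensor3 \<Rightarrow> _)" by (rule cstar_rel_form(1)[OF A.fin_base])
  have gen: "cstar_rel_form v w = cnj (cstar_rel_form w v)"
    if "v \<in> generators" "w \<in> generators" for v w
  proof -
    obtain \<xi> \<omega> \<eta> where v: "v = \<xi> \<otimes> \<omega> \<otimes> \<eta>" "\<xi> \<in> \<alpha>" "\<eta> \<in> \<beta>" using \<open>v \<in> generators\<close> by blast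
    obtain \<xi>' \<omega>' \<eta>' where w: "w = \<xi>' \<otimes> \<omega>' \<otimes> \<eta>'" "\<xi>' \<in> \<alpha>" "\<eta>' \<in> \<beta>" using \<open>w \<in> generators\<close> by blast
    have "cstar_rel_form v w = cinner \<omega> (adj \<eta> \<cdot> \<eta>' \<cdot> adj \<xi> \<cdot> \<xi>' \<cdot> \<omega>')"
      by (simp only: v(1) w(1) cstar_rel_form(2)[OF A.fin_base] commute[OF v(2) w(2) v(3) w(3)])
    also have "\<dots> = cinner (adj \<xi>' \<cdot> \<xi> \<cdot> adj \<eta>' \<cdot> \<eta> \<cdot> \<omega>) \<omega>'"
      by (simp only: cinner_adj_left[OF A.fin_base] cinner_adj_right[OF A.fin_base, symmetric])
    also have "\<dots> = cnj (cstar_rel_form w v)"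
      by (simp only: v(1) w(1) cstar_rel_form(2)[OF A.fin_base] flip: cinner_commute)
    finally show ?thesis .
  qed
  have "cspan generators \<subseteq> {w. cstar_rel_form v w = cnj (cstar_rel_form w v)}" if "v \<in> generators" for v
    using gen[OF that] by (intro complex_vector.span_minimal) (auto simp: complex_vector.subspace_def form_simps)
  then have "cspan generators \<subseteq> {v. \<forall>w\<in>cspan generators. cstar_rel_form v w = cnj (cstar_rel_form w v)}"
    by (intro complex_vector.span_minimal) (auto simp: complex_vector.subspace_def form_simps)
  then show "cstar_rel_form v w = cnj (cstar_rel_form w v)"
    if "v \<in> cspan generators" "w \<in> cspan generators" for v w
    using that by blast
  fix v assume "v \<in> cspan generators"
  then obtain n \<xi> \<omega> \<eta> where v: "\<And>i. \<xi> i \<in> \<alpha>" "\<And>i. \<eta> i \<in> \<beta>" "v = (\<Sum>i<n::nat. \<xi> i \<otimes> \<omega> i \<otimes> \<eta> i)"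
    using generators_sum by blast
  have "cstar_rel_form v v =
      (\<Sum>i<n. \<Sum>j<n. cinner (\<omega> i) (adj (\<xi> i) \<cdot> \<xi> j \<cdot> adj (\<eta> i) \<cdot> \<eta> j \<cdot> \<omega> j))"
    by (simp add: v(3) form_simps cstar_rel_form(2) A.fin_base) (rule sum.swap)
  then show "0 \<le> Re (cstar_rel_form v v)"
    using schur_product_positive[OF A.fin_base, of "{..<n}" \<xi> \<eta> \<omega>] commute v by simp
qed

text \<open>
  The linear map \<open>\<xi> \<otimes> \<eta> \<mapsto> R(\<xi>) U \<otimes> \<zeta> \<otimes> R(\<eta>) U\<close>, with \<open>R(\<xi>) U\<close> and \<open>R(\<eta>) U\<close> in the form of
  \<open>lift_vector\<close>.
\<close>

definition fuse :: "('h, 'k) tensor \<Rightarrow> ('b, 'h, 'k) tensor3" where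
  "fuse = tensor_ext (\<lambda>x y. A.lift_vector x \<otimes> \<zeta> \<otimes> C.lift_vector y)"

lemma fuse: "fuse (u + v) = fuse u + fuse v" "fuse (c *\<^sub>C u) = c *\<^sub>C fuse u"
  "fuse (x \<otimes> y) = A.lift_vector x \<otimes> \<zeta> \<otimes> C.lift_vector y"
proof -
  have "cbilinear (\<lambda>x y. A.lift_vector x \<otimes> \<zeta> \<otimes> C.lift_vector y)"
    by (simp add: cbilinear_def A.lift_add A.lift_scaleC C.lift_add C.lift_scaleC
        tensor_add_left tensor_add_right tensor_scale_left tensor_scale_right)
  then show "fuse (u + v) = fuse u + fuse v" "fuse (c *\<^sub>C u) = c *\<^sub>C fuse u"
    "fuse (x \<otimes> y) = A.lift_vector x \<otimes> \<zeta> \<otimes> C.lift_vector y"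
    unfolding fuse_def by (rule tensor_ext_add tensor_ext_scale tensor_ext_tensor)+
qed

lemma fuse_in: "fuse u \<in> cspan generators"
proof -
  have "csubspace {u. fuse u \<in> cspan generators}"
    using fuse(2)[of 0 0]
    by (auto simp: complex_vector.subspace_def fuse complex_vector.span_add complex_vector.span_scale
        complex_vector.span_zero)
  moreover have "fuse (x \<otimes> y) \<in> cspan generators" for x y
    unfolding fuse using A.lift_in C.lift_in by (intro complex_vector.span_base) blast
  ultimately have "cspan {x \<otimes> y | x y. True} \<subseteq> {u. fuse u \<in> cspan generators}"
    by (intro complex_vector.span_minimal) auto
  then show ?thesis unfolding cspan_tensor by blast
qed

text \<open>
  Elements of \<open>B\<close> move from the middle factor to the left one: for \<open>\<omega> = b \<zeta>\<close>, the tensors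
  \<open>\<xi> \<otimes> \<omega> \<otimes> \<eta>\<close> and \<open>\<xi> b \<otimes> \<zeta> \<otimes> \<eta>\<close> differ by a null vector, and the latter is in the range of
  \<open>fuse\<close>.
\<close>

lemma fuse_dense:
  assumes "w \<in> cspan generators" shows "\<exists>u. \<forall>x. cstar_rel_form (w - fuse u) x = 0"
proof -
  have "csubspace {w. \<exists>u. \<forall>x. cstar_rel_form (w - fuse u) x = 0}"
  proof (rule complex_vector.subspaceI)
    show "0 \<in> {w. \<exists>u. \<forall>x. cstar_rel_form (w - fuse u) x = 0}"
      using fuse(2)[of 0 0] by (auto simp: form_simps intro!: exI[of _ 0])
  next
    fix v w assume "v \<in> {w. \<exists>u. \<forall>x. cstar_rel_form (w - fuse u) x = 0}"
      "w \<in> {w. \<exists>u. \<forall>x. cstar_rel_form (w - fuse u) x = 0}"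
    then obtain u u' where "\<forall>x. cstar_rel_form (v - fuse u) x = 0" "\<forall>x. cstar_rel_form (w - fuse u') x = 0"
      by blast
    then show "v + w \<in> {w. \<exists>u. \<forall>x. cstar_rel_form (w - fuse u) x = 0}"
      by (auto simp: fuse form_simps intro!: exI[of _ "u + u'"])
  next
    fix c w assume "w \<in> {w. \<exists>u. \<forall>x. cstar_rel_form (w - fuse u) x = 0}"
    then obtain u where "\<forall>x. cstar_rel_form (w - fuse u) x = 0" by blast
    then show "c *\<^sub>C w \<in> {w. \<exists>u. \<forall>x. cstar_rel_form (w - fuse u) x = 0}"
      by (auto simp: fuse form_simps intro!: exI[of _ "c *\<^sub>C u"])
  qed
  moreover have "\<exists>u. \<forall>x. cstar_rel_form (\<xi> \<otimes> \<omega> \<otimes> \<eta> - fuse u) x = 0"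
    if \<xi>: "\<xi> \<in> \<alpha>" and \<eta>: "\<eta> \<in> \<beta>" for \<xi> \<omega> \<eta>
  proof -
    obtain b where b: "b \<in> B" "b \<cdot> \<zeta> = \<omega>" using A.cyclic by blast
    have u: "fuse ((\<xi> \<cdot> \<omega>) \<otimes> (\<eta> \<cdot> \<zeta>)) = (\<xi> o\<^sub>C b) \<otimes> \<zeta> \<otimes> \<eta>"
      using A.lift_compose[OF b(1) \<xi>] C.lift_vectorI[OF \<eta> refl] by (simp add: fuse b(2))
    have "adj (\<xi> o\<^sub>C b) = adj b o\<^sub>C adj \<xi>"
      by (rule adj_cblin_compose) (simp_all add: cinner_adj_left A.fin_base)
    then have "cstar_rel_form (\<xi> \<otimes> \<omega> \<otimes> \<eta> - fuse ((\<xi> \<cdot> \<omega>) \<otimes> (\<eta> \<cdot> \<zeta>))) (\<xi>' \<otimes> \<omega>' \<otimes> \<eta>') = 0" for \<xi>' \<omega>' \<eta>'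
      unfolding u by (simp add: form_simps cstar_rel_form(2) A.fin_base cinner_adj_right b(2))
    then have "cspan {\<xi> \<otimes> \<omega> \<otimes> \<eta> | \<xi> \<omega> \<eta>. True} \<subseteq>
        {x. cstar_rel_form (\<xi> \<otimes> \<omega> \<otimes> \<eta> - fuse ((\<xi> \<cdot> \<omega>) \<otimes> (\<eta> \<cdot> \<zeta>))) x = 0}"
      by (intro complex_vector.span_minimal)
        (auto simp: complex_vector.subspace_def sesquilinear_simps(2,4,6)[OF cstar_rel_form(1)[OF A.fin_base]])
    then show ?thesis unfolding cspan_tensor3 by blast
  qed
  ultimately have "cspan generators \<subseteq> {w. \<exists>u. \<forall>x. cstar_rel_form (w - fuse u) x = 0}"
    by (intro complex_vector.span_minimal) auto
  then show ?thesis using assms by blast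
qed

lemma semi_inner_fuse: "semi_inner UNIV (\<lambda>u v. cstar_rel_form (fuse u) (fuse v))"
proof -
  interpret T: semi_inner "cspan generators" cstar_rel_form by (rule semi_inner_form)
  show ?thesis
  proof
    show "sesquilinear (\<lambda>u v. cstar_rel_form (fuse u) (fuse v))"
      by (simp add: sesquilinear_def fuse form_simps)
    show "cstar_rel_form (fuse u) (fuse v) = cnj (cstar_rel_form (fuse v) (fuse u))" for u v
      by (rule T.hermitian[OF fuse_in fuse_in])
  qed (simp_all add: complex_vector.subspace_UNIV T.nonneg fuse_in)
qed

text \<open>
  \<open>fuse\<close> is isometric: with \<open>a\<close>, \<open>a'\<close>, \<open>c\<close>, \<open>c'\<close> for the lifted vectors, both forms have the value
  \<open>\<langle>\<zeta> | a\<^sup>* a' c\<^sup>* c' \<zeta>\<rangle>\<close> on elementary tensors.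
\<close>

lemma rel_form_eq:
  fixes \<pi> :: "'n::cstar_algebra \<Rightarrow> ('m::chilbert_space, 'm) cblin" and U :: "('b, 'm) cblin"
  assumes U: "unitary_op U" "U \<cdot> \<zeta> = \<zeta>\<^sub>\<mu>"
    and R1: "\<And>x. R_op (op_rep \<pi> \<zeta>\<^sub>\<mu>) \<zeta>\<^sub>\<mu> \<rho> x = A.lift_vector x o\<^sub>C adj U"
    and R2: "\<And>y. R_op \<pi> \<zeta>\<^sub>\<mu> \<sigma> y = C.lift_vector y o\<^sub>C adj U"
  shows "rel_form \<pi> \<zeta>\<^sub>\<mu> \<rho> \<sigma> = (\<lambda>u v. cstar_rel_form (fuse u) (fuse v))"
proof -
  have UU: "adj U \<cdot> U \<cdot> x = x" for x
    using U(1) by (metis cblin_compose_apply id_cblin_apply unitary_op_def)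
  have U\<zeta>: "adj U \<cdot> \<zeta>\<^sub>\<mu> = \<zeta>" using UU[of \<zeta>] by (simp add: U(2))
  have adj_R: "adj (a o\<^sub>C adj U) = U o\<^sub>C adj a" for a :: "('b, 'c::chilbert_space) cblin"
    by (rule adj_eqI) (simp add: cinner_adj_left[OF A.fin_base] flip: cinner_adj_right[OF A.fin_base])
  have iso: "cinner (U \<cdot> x) (U \<cdot> y) = cinner x y" for x y
    by (simp add: UU flip: cinner_adj_right[OF A.fin_base])
  let ?v = "\<lambda>\<xi> \<eta> \<xi>' \<eta>'. cinner
        (adj (R_op (op_rep \<pi> \<zeta>\<^sub>\<mu>) \<zeta>\<^sub>\<mu> \<rho> \<xi>') \<cdot> R_op (op_rep \<pi> \<zeta>\<^sub>\<mu>) \<zeta>\<^sub>\<mu> \<rho> \<xi> \<cdot> \<zeta>\<^sub>\<mu>)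
        (adj (R_op \<pi> \<zeta>\<^sub>\<mu> \<sigma> \<eta>) \<cdot> R_op \<pi> \<zeta>\<^sub>\<mu> \<sigma> \<eta>' \<cdot> \<zeta>\<^sub>\<mu>)"
  have val: "cstar_rel_form (fuse (\<xi> \<otimes> \<eta>)) (fuse (\<xi>' \<otimes> \<eta>')) = ?v \<xi> \<eta> \<xi>' \<eta>'" for \<xi> \<eta> \<xi>' \<eta>'
    by (simp add: fuse cstar_rel_form(2) A.fin_base R1 R2 adj_R U\<zeta> iso)
      (simp only: cinner_adj_left[OF A.fin_base], simp only: cinner_adj_right[OF A.fin_base])
  have sesq: "sesquilinear (\<lambda>u v. cstar_rel_form (fuse u) (fuse v))"
    by (rule semi_inner.sesquilinear[OF semi_inner_fuse])
  show ?thesis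
    unfolding rel_form_def
  proof (rule the_equality)
    show "sesquilinear (\<lambda>u v. cstar_rel_form (fuse u) (fuse v)) \<and>
        (\<forall>\<xi> \<eta> \<xi>' \<eta>'. cstar_rel_form (fuse (\<xi> \<otimes> \<eta>)) (fuse (\<xi>' \<otimes> \<eta>')) = ?v \<xi> \<eta> \<xi>' \<eta>')"
      using sesq val by blast
    fix f assume f: "sesquilinear f \<and> (\<forall>\<xi> \<eta> \<xi>' \<eta>'. f (\<xi> \<otimes> \<eta>) (\<xi>' \<otimes> \<eta>') = ?v \<xi> \<eta> \<xi>' \<eta>')"
    show "f = (\<lambda>u v. cstar_rel_form (fuse u) (fuse v))"
    proof (rule sesquilinear_unique[OF _ sesq cspan_tensor])
      show "sesquilinear f" using f by blast
      fix u v :: "('h, 'k) tensor"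
      assume "u \<in> {x \<otimes> y | x y. True}" "v \<in> {x \<otimes> y | x y. True}"
      then obtain \<xi> \<eta> \<xi>' \<eta>' where "u = \<xi> \<otimes> \<eta>" "v = \<xi>' \<otimes> \<eta>'" by blast
      then show "f u v = cstar_rel_form (fuse u) (fuse v)" using f val by simp
    qed
  qed
qed

end

theorem proposition2p10:
  fixes \<mu> :: "('n::cstar_algebra, complex) cblin"
    and \<pi> :: "'n \<Rightarrow> ('m::chilbert_space, 'm) cblin" and \<zeta>\<^sub>\<mu> :: 'm
    and \<rho> :: "'n opp \<Rightarrow> ('h::chilbert_space, 'h) cblin"
    and \<sigma> :: "'n \<Rightarrow> ('k::chilbert_space, 'k) cblin"
    and B B' :: "('b::chilbert_space, 'b) cblin set" and \<zeta> :: 'b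
    and \<alpha> :: "('b, 'h) cblin set" and \<beta> :: "('b, 'k) cblin set"
    and U :: "('b, 'm) cblin"
  assumes "cfinite_dim (UNIV :: 'h set)" and "cfinite_dim (UNIV :: 'k set)"
    and "cfinite_dim (UNIV :: 'n set)"
    and "faithful_state \<mu>"
    and "gns_representation \<mu> \<pi> \<zeta>\<^sub>\<mu>"
    and "star_representation \<rho>" and "nondegenerate_rep \<rho>" and "inj \<rho>"
    and "star_representation \<sigma>" and "nondegenerate_rep \<sigma>" and "inj \<sigma>"
    and "cfinite_dim (UNIV :: 'b set)"
    and "cstar_base B B'" and "bicyclic_vector B B' \<zeta>"
    and "cstar_factorization B \<alpha>" and "cstar_factorization B' \<beta>"
    and "unitary_op U"
    and "Ad U ` B = range \<pi>"
    and "Ad U ` B' = range (op_rep \<pi> \<zeta>\<^sub>\<mu>)"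
    and "U \<cdot> \<zeta> = \<zeta>\<^sub>\<mu>"
    and "\<rho> = factorization_rep \<alpha> \<circ> Ad (adj U) \<circ> op_rep \<pi> \<zeta>\<^sub>\<mu>"
    and "\<sigma> = factorization_rep \<beta> \<circ> Ad (adj U) \<circ> \<pi>"
  shows "\<exists>\<Phi>. unitary_map (rel_tensor \<pi> \<zeta>\<^sub>\<mu> \<rho> \<sigma>) (cstar_rel_tensor \<alpha> \<beta>) \<Phi> \<and>
    (\<forall>\<xi> \<eta>. R_op (op_rep \<pi> \<zeta>\<^sub>\<mu>) \<zeta>\<^sub>\<mu> \<rho> \<xi> o\<^sub>C U \<in> \<alpha> \<and> R_op \<pi> \<zeta>\<^sub>\<mu> \<sigma> \<eta> o\<^sub>C U \<in> \<beta> \<and>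
      \<Phi> (rel_elem \<pi> \<zeta>\<^sub>\<mu> \<rho> \<sigma> \<xi> \<eta>) =
        cstar_rel_elem \<alpha> \<beta> (R_op (op_rep \<pi> \<zeta>\<^sub>\<mu>) \<zeta>\<^sub>\<mu> \<rho> \<xi> o\<^sub>C U) \<zeta> (R_op \<pi> \<zeta>\<^sub>\<mu> \<sigma> \<eta> o\<^sub>C U))"
proof -
  have "cstar_base B' B" "bicyclic_vector B' B \<zeta>"
    using \<open>cstar_base B B'\<close> \<open>bicyclic_vector B B' \<zeta>\<close>
    by (auto simp: cstar_base_def bicyclic_vector_def)
  then interpret factorization_pair B B' \<zeta> \<alpha> \<beta>
    using assms by (intro factorization_pair.intro cyclic_factorizationI)
  have R1: "R_op (op_rep \<pi> \<zeta>\<^sub>\<mu>) \<zeta>\<^sub>\<mu> \<rho> x = A.lift_vector x o\<^sub>C adj U" for x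
    using assms by (intro A.R_op_eq)
  have R2: "R_op \<pi> \<zeta>\<^sub>\<mu> \<sigma> y = C.lift_vector y o\<^sub>C adj U" for y
    using assms by (intro C.R_op_eq)
  have RU: "(a o\<^sub>C adj U) o\<^sub>C U = a" for a :: "('b, 'c::chilbert_space) cblin"
  proof (rule cblin_eqI)
    fix x
    have "adj U \<cdot> U \<cdot> x = x"
      using \<open>unitary_op U\<close> by (metis cblin_compose_apply id_cblin_apply unitary_op_def)
    then show "((a o\<^sub>C adj U) o\<^sub>C U) \<cdot> x = a \<cdot> x" by simp
  qed
  have form: "rel_form \<pi> \<zeta>\<^sub>\<mu> \<rho> \<sigma> = (\<lambda>u v. cstar_rel_form (fuse u) (fuse v))"
    by (rule rel_form_eq[OF \<open>unitary_op U\<close> \<open>U \<cdot> \<zeta> = \<zeta>\<^sub>\<mu>\<close> R1 R2])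
  have "\<exists>\<Phi>. unitary_map (rel_tensor \<pi> \<zeta>\<^sub>\<mu> \<rho> \<sigma>) (cstar_rel_tensor \<alpha> \<beta>) \<Phi> \<and>
      (\<forall>u. \<Phi> (sep_class (rel_form_space \<pi> \<zeta>\<^sub>\<mu> \<rho> \<sigma>) u) =
        sep_completion_class (cstar_rel_form_space \<alpha> \<beta>) (fuse u))"
    unfolding rel_tensor_def rel_form_space_def cstar_rel_tensor_def cstar_rel_form_space_def form
  proof (rule unitary_separation_completion)
    show "cfinite_dim (UNIV :: ('h, 'k) tensor set)"
      using assms by (intro cfinite_dim_tensor)
    show "\<exists>u. cstar_rel_form (w - fuse u) (w - fuse u) = 0" if "w \<in> cspan generators" for w
      using fuse_dense[OF that] by blast
  qed (simp_all add: semi_inner_fuse semi_inner_form fuse fuse_in)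
  then show ?thesis
    unfolding rel_elem_def cstar_rel_elem_def R1 R2 RU using A.lift_in C.lift_in fuse(3) by metis
qed

end
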